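(* Let $P_{11}$ be a path on eleven vertices. In the $(1:b)$ biased $P_{11}$-minor game on $K_n$ with bias $b=0.99n$, {\tt CleverBreaker} has a strategy which wins with probability tending to $1$ as $n\to\infty$ against {\tt RandomMaker}.
   Context: A $(1:b)$ biased Maker–Breaker game on $K_n$ is played on the board $E(K_n)$: in each round Maker claims one unclaimed edge and then Breaker claims $b$ unclaimed edges (fewer if fewer remain), until all edges are claimed. $M$ denotes Maker's graph at the end. In the $H$-minor game Maker wins iff $H$ is a minor of $M$ (i.e. there exist pairwise disjoint non-empty sets $S_v\subseteq V(M)$, $v\in V(H)$, each inducing a connected subgraph of $M$, with an edge of $M$ between $S_v$ and $S_w$ whenever $vw\in E(H)$); otherwise Breaker wins. {\tt RandomMaker} chooses each of its edges uniformly at random among the currently unclaimed edges; {\tt CleverBreaker} plays a strategy of its choosing. *)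

theory Defs
  imports "HOL-Probability.Probability"
begin

section \<open>Graphs and minors\<close>

text \<open>A graph is a pair of a vertex set and a set of two-element sets of vertices.\<close>

type_synonym 'a graph = "'a set \<times> 'a set set"

definition complete_graph :: "nat \<Rightarrow> nat graph" where
  "complete_graph n = ({..<n}, {e. e \<subseteq> {..<n} \<and> card e = 2})"

definition path_graph :: "nat \<Rightarrow> nat graph" where
  "path_graph k = ({..<k}, {{i, Suc i} | i. Suc i < k})"

definition induces_connected :: "'a graph \<Rightarrow> 'a set \<Rightarrow> bool" where
  "induces_connected G S \<longleftrightarrow>
     S \<noteq> {} \<and> S \<subseteq> fst G \<and>
     (\<forall>u\<in>S. \<forall>v\<in>S. (u, v) \<in> {(x, y). x \<in> S \<and> y \<in> S \<and> {x, y} \<in> snd G}\<^sup>*)"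

definition is_minor :: "'a graph \<Rightarrow> 'b graph \<Rightarrow> bool" where
  "is_minor H G \<longleftrightarrow>
     (\<exists>S. (\<forall>v\<in>fst H. induces_connected G (S v)) \<and>
          disjoint_family_on S (fst H) \<and>
          (\<forall>v w. {v, w} \<in> snd H \<longrightarrow> (\<exists>x\<in>S v. \<exists>y\<in>S w. {x, y} \<in> snd G)))"

section \<open>The biased game with a random Maker\<close>

text \<open>
  A history lists the completed rounds in chronological order, each as the edge claimed by
  Maker and the set of edges claimed by Breaker in reply.  Breaker's reply may depend on the
  whole history and on Maker's edge in the current round.
\<close>

type_synonym history = "(nat set \<times> nat set set) list"
type_synonym strategy = "history \<Rightarrow> nat set \<Rightarrow> nat set set"

definition maker_edges :: "history \<Rightarrow> nat set set" where
  "maker_edges h = fst ` set h"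

definition breaker_edges :: "history \<Rightarrow> nat set set" where
  "breaker_edges h = \<Union> (snd ` set h)"

definition unclaimed :: "nat \<Rightarrow> history \<Rightarrow> nat set set" where
  "unclaimed n h = snd (complete_graph n) - (maker_edges h \<union> breaker_edges h)"

definition breaker_strategy :: "nat \<Rightarrow> nat \<Rightarrow> strategy \<Rightarrow> bool" where
  "breaker_strategy n b \<sigma> \<longleftrightarrow>
     (\<forall>h. \<forall>e\<in>unclaimed n h.
        \<sigma> h e \<subseteq> unclaimed n h - {e} \<and>
        card (\<sigma> h e) = min b (card (unclaimed n h - {e})))"

definition play_round :: "nat \<Rightarrow> strategy \<Rightarrow> history \<Rightarrow> history pmf" where
  "play_round n \<sigma> h =
     (if unclaimed n h = {} then return_pmf h
      else map_pmf (\<lambda>e. h @ [(e, \<sigma> h e)]) (pmf_of_set (unclaimed n h)))"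

primrec play_rounds :: "nat \<Rightarrow> strategy \<Rightarrow> nat \<Rightarrow> history pmf" where
  "play_rounds n \<sigma> 0 = return_pmf []"
| "play_rounds n \<sigma> (Suc t) = bind_pmf (play_rounds n \<sigma> t) (play_round n \<sigma>)"

text \<open>
  Every round claims at least one edge and a finished game no longer changes, so after as many
  rounds as there are edges the game is over (lemma \<open>unclaimed_random_play\<close> below).
\<close>

definition random_play :: "nat \<Rightarrow> strategy \<Rightarrow> history pmf" where
  "random_play n \<sigma> = play_rounds n \<sigma> (card (snd (complete_graph n)))"

definition maker_graph :: "nat \<Rightarrow> history \<Rightarrow> nat graph" where
  "maker_graph n h = ({..<n}, maker_edges h)"

definition breaker_win_prob :: "'a graph \<Rightarrow> nat \<Rightarrow> strategy \<Rightarrow> real" where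
  "breaker_win_prob H n \<sigma> =
     measure_pmf.prob (random_play n \<sigma>) {h. \<not> is_minor H (maker_graph n h)}"

lemma finite_unclaimed: "finite (unclaimed n h)"
  by (rule finite_subset[of _ "Pow {..<n}"]) (auto simp: unclaimed_def complete_graph_def)

lemma unclaimed_play_rounds:
  "h \<in> set_pmf (play_rounds n \<sigma> t) \<Longrightarrow> card (unclaimed n h) \<le> card (snd (complete_graph n)) - t"
proof (induction t arbitrary: h)
  case 0
  then show ?case by (simp add: unclaimed_def maker_edges_def breaker_edges_def)
next
  case (Suc t)
  then obtain h' where h': "h' \<in> set_pmf (play_rounds n \<sigma> t)" "h \<in> set_pmf (play_round n \<sigma> h')"
    by auto
  show ?case
  proof (cases "unclaimed n h' = {}")
    case True
    then show ?thesis using h'(2) by (simp add: play_round_def)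
  next
    case False
    then obtain e where e: "e \<in> unclaimed n h'" "h = h' @ [(e, \<sigma> h' e)]"
      using h'(2) finite_unclaimed by (auto simp: play_round_def)
    have "unclaimed n h \<subseteq> unclaimed n h' - {e}"
      by (auto simp: e(2) unclaimed_def maker_edges_def breaker_edges_def)
    then have "card (unclaimed n h) \<le> card (unclaimed n h' - {e})"
      by (intro card_mono) (auto simp: finite_unclaimed)
    also have "\<dots> = card (unclaimed n h') - 1"
      using e(1) by (simp add: finite_unclaimed)
    finally show ?thesis using Suc.IH[OF h'(1)] by linarith
  qed
qed

lemma unclaimed_random_play: "h \<in> set_pmf (random_play n \<sigma>) \<Longrightarrow> unclaimed n h = {}"
  using unclaimed_play_rounds[of h n \<sigma> "card (snd (complete_graph n))"] finite_unclaimed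
  by (simp add: random_play_def)

end

theory Submission
  imports Defs "HOL-Real_Asymp.Real_Asymp"
begin

text \<open>
  Breaker isolates vertices one after the other. If a Maker edge creates or enlarges a star, Breaker
  condemns the new leaf; any other Maker edge is \<^emph>\<open>dangerous\<close>, and the vertices of the components it
  touches become urgent and are isolated first. The unclaimed edges nearly form a complete graph
  on the live vertices, so the number of live vertices is a function of the time. Isolating one vertex
  costs slightly more than one round in the beginning and less later on, hence exponential moment
  bounds show that the backlog of condemned vertices stays below \<open>n / 1000\<close>, that it is empty at some time
  when Breaker can isolate three vertices per round (and then remains empty), and that an urgent
  period, in which urgent vertices are present throughout, has fewer than \<open>n powr (1 / 5)\<close> rounds. So
  with high probability no Maker edge joins two urgent vertices, and no two Maker edges of one
  urgent period hit urgent vertices. Then no path of Maker contains three dangerous edges.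
  Since non-dangerous edges form a star forest, at least one of three consecutive edges of a path is
  dangerous; hence there is no path with ten edges.
\<close>

section \<open>Breaker's strategy\<close>

text \<open>The obstacle is \<open>b < n\<close>: at first Breaker's reply isolates less than one
  vertex, while a star move condemns one. If y is the live fraction of the vertices, a round
  isolates about 0.99 / y vertices and condemns at most 1 plus, on average, the probability of a
  dangerous move. Two old centres are joined with probability at most 6/5 (1 - y)^2 / y, so for y
  \<ge> 0.45 the drift of the backlog is at most (0.0141 - z + 6/5 z^2) / y with z = 1 - y, which is
  positive only for z < 0.0145. Of the 0.0141, 0.01 is the missing bias and 0.0041 pays for moves at
  condemned vertices and their centres, which presupposes the very backlog bound to be proved. To
  break this circle the random sums skip rounds whose history is not \<open>calm\<close> or
  \<open>quiet\<close>; their tail bounds need no assumption, and induction on time shows that a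
  typical play skips no relevant round. The window length \<open>W\<close> must outgrow log n, for a
  union bound over the starts of long urgent periods, and W^4 must be o(n), because two hits within
  one of about n windows have total probability of order n (W^2 / n)^2.\<close>

lemma serve_exists:
  fixes A :: "'a set set"
  assumes "finite A"
  shows "\<exists>R\<subseteq>A. card R = min b (card A) \<and>
    (\<forall>ys z zs. xs = ys @ z # zs \<longrightarrow> (\<exists>f\<in>A - R. z \<in> f) \<longrightarrow> (\<forall>f\<in>R. \<exists>v\<in>insert z (set ys). v \<in> f))"
  using assms
proof (induction xs arbitrary: A b)
  case Nil
  obtain R where "R \<subseteq> A" "card R = min b (card A)"
    using obtain_subset_with_card_n[of "min b (card A)" A] by (metis min.cobounded2)
  then show ?case by (intro exI[of _ R]) simp
next
  case (Cons x xs)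
  define Ax where "Ax = {f\<in>A. x \<in> f}"
  have Ax: "Ax \<subseteq> A" "finite Ax"
    using Cons.prems by (auto simp: Ax_def)
  show ?case
  \<comment> \<open>Greedy choice: serve the head completely and spend the rest of the budget on the
    tail, or, if the head has too many edges, spend everything there.\<close>
  proof (cases "card Ax \<le> b")
    case True
    have "finite (A - Ax)"
      using Cons.prems by simp
    from Cons.IH[OF this, of "b - card Ax"] obtain R where R: "R \<subseteq> A - Ax"
      "card R = min (b - card Ax) (card (A - Ax))"
      "\<forall>ys z zs. xs = ys @ z # zs \<longrightarrow> (\<exists>f\<in>A - Ax - R. z \<in> f) \<longrightarrow>
        (\<forall>f\<in>R. \<exists>v\<in>insert z (set ys). v \<in> f)"
      by (elim exE conjE) (rule that)
    have "card (Ax \<union> R) = card Ax + card R"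
      using R(1) Ax(2) Cons.prems by (intro card_Un_disjoint) (auto intro: finite_subset)
    also have "\<dots> = min b (card A)"
      using R(2) True Ax Cons.prems card_mono[OF Cons.prems Ax(1)] by (simp add: card_Diff_subset)
    finally have card: "card (Ax \<union> R) = min b (card A)" .
    have "\<exists>v\<in>insert z (set ys). v \<in> f"
      if eq: "x # xs = ys @ z # zs" and ex: "\<exists>f\<in>A - (Ax \<union> R). z \<in> f" and f: "f \<in> Ax \<union> R" for ys z zs f
    proof (cases ys)
      case Nil
      then show ?thesis
        using eq ex by (auto simp: Ax_def)
    next
      case (Cons y ys')
      then have eqs: "y = x" "xs = ys' @ z # zs"
        using eq by auto
      show ?thesis
      proof (cases "f \<in> Ax")
        case True
        then show ?thesis using Cons eqs by (auto simp: Ax_def)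
      next
        case False
        then have "f \<in> R" using f by simp
        moreover have "\<exists>f\<in>A - Ax - R. z \<in> f" using ex by auto
        ultimately show ?thesis using R(3)[rule_format, OF eqs(2)] Cons by auto
      qed
    qed
    then show ?thesis
      using card R(1) Ax(1) by (intro exI[of _ "Ax \<union> R"]) blast
  next
    case False
    then obtain R where R: "R \<subseteq> Ax" "card R = b"
      using obtain_subset_with_card_n[of b Ax] by auto
    have "b \<le> card A"
      using False card_mono[OF Cons.prems Ax(1)] by simp
    moreover have "\<exists>v\<in>insert z (set ys). v \<in> f"
      if "x # xs = ys @ z # zs" "f \<in> R" for ys z zs f
      using that R(1) by (cases ys) (auto simp: Ax_def)
    ultimately show ?thesis
      using R Ax(1) by (intro exI[of _ R]) (auto simp: min_def)
  qed
qed

text \<open>The list is a priority order: no edge is spent on later entries alone while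
  \<open>z\<close> still has an unclaimed edge. Which edges are taken within this rule is
  irrelevant, hence \<open>SOME\<close>.\<close>

definition serve :: "nat \<Rightarrow> 'a set set \<Rightarrow> 'a list \<Rightarrow> 'a set set" where
  "serve b A xs = (SOME R. R \<subseteq> A \<and> card R = min b (card A) \<and>
    (\<forall>ys z zs. xs = ys @ z # zs \<longrightarrow> (\<exists>f\<in>A - R. z \<in> f) \<longrightarrow> (\<forall>f\<in>R. \<exists>v\<in>insert z (set ys). v \<in> f)))"

lemma serve:
  assumes "finite A"
  shows serve_subset: "serve b A xs \<subseteq> A"
    and card_serve: "card (serve b A xs) = min b (card A)"
    and serve_order: "\<And>ys z zs f. xs = ys @ z # zs \<Longrightarrow> \<exists>g\<in>A - serve b A xs. z \<in> g \<Longrightarrow>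
      f \<in> serve b A xs \<Longrightarrow> \<exists>v\<in>insert z (set ys). v \<in> f"
proof -
  let ?P = "\<lambda>R. R \<subseteq> A \<and> card R = min b (card A) \<and>
    (\<forall>ys z zs. xs = ys @ z # zs \<longrightarrow> (\<exists>f\<in>A - R. z \<in> f) \<longrightarrow> (\<forall>f\<in>R. \<exists>v\<in>insert z (set ys). v \<in> f))"
  have P: "?P (serve b A xs)"
    unfolding serve_def by (rule someI_ex[of ?P]) (use serve_exists[OF assms, of b xs] in blast)
  show "serve b A xs \<subseteq> A" and "card (serve b A xs) = min b (card A)"
    using P by simp_all
  show "\<exists>v\<in>insert z (set ys). v \<in> f"
    if "xs = ys @ z # zs" "\<exists>g\<in>A - serve b A xs. z \<in> g" "f \<in> serve b A xs" for ys z zs f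
    using P that by blast
qed

text \<open>
  Breaker's bookkeeping: \<open>leaves\<close> are condemned leaves of Maker's stars, \<open>urgent\<close> contains the
  components hit by a dangerous Maker edge, \<open>dead\<close> are the vertices Breaker has finished isolating
  and \<open>current\<close> is the vertex that is possibly isolated only in part.
\<close>

datatype state = State (leaves: "nat set") (urgent: "nat set") (dead: "nat set") (current: nat)

definition component :: "nat set set \<Rightarrow> nat \<Rightarrow> nat set" where
  "component M v = {w. (v, w) \<in> {(x, y). {x, y} \<in> M}\<^sup>*}"

definition fresh :: "history \<Rightarrow> nat \<Rightarrow> bool" where
  "fresh h v \<longleftrightarrow> v \<notin> \<Union> (maker_edges h)"

text \<open>In a consistent history a clean vertex is untouched or the centre of a star whose leaves
  are all dead. Allowing new leaves only at such centres keeps at most one live leaf per star, which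
  bounds what a dangerous move can make urgent.\<close>

definition clean :: "state \<Rightarrow> history \<Rightarrow> nat \<Rightarrow> bool" where
  "clean s h v \<longleftrightarrow> v \<notin> urgent s \<and> v \<notin> leaves s \<and> (\<forall>w\<in>leaves s - dead s. {v, w} \<notin> maker_edges h)"

definition star_move :: "state \<Rightarrow> history \<Rightarrow> nat set \<Rightarrow> bool" where
  "star_move s h e \<longleftrightarrow> (\<forall>v\<in>e. clean s h v) \<and> (\<exists>v\<in>e. fresh h v)"

text \<open>If both ends are fresh, either could be the leaf; \<open>LEAST\<close> merely breaks the
  tie.\<close>

definition new_leaf :: "history \<Rightarrow> nat set \<Rightarrow> nat" where
  "new_leaf h e = (LEAST v. v \<in> e \<and> fresh h v)"

definition leaves_after :: "state \<Rightarrow> history \<Rightarrow> nat set \<Rightarrow> nat set" where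
  "leaves_after s h e = (if star_move s h e then insert (new_leaf h e) (leaves s) else leaves s)"

definition urgent_after :: "state \<Rightarrow> history \<Rightarrow> nat set \<Rightarrow> nat set" where
  "urgent_after s h e =
     (if star_move s h e then urgent s else urgent s \<union> (\<Union>v\<in>e. component (maker_edges h) v))"

text \<open>Putting \<open>current\<close> first ensures that only one live vertex is partly
  isolated. Together with it, the urgent vertices and the whole backlog each form an initial
  segment. The final \<open>[0..<n]\<close> lets Breaker go on isolating when nothing is condemned,
  so that the number of live vertices follows the clock. Repetitions are harmless.\<close>

definition queue :: "nat \<Rightarrow> state \<Rightarrow> history \<Rightarrow> nat set \<Rightarrow> nat list" where
  "queue n s h e = current s # filter (\<lambda>v. v \<in> urgent_after s h e) [0..<n]
     @ filter (\<lambda>v. v \<in> leaves_after s h e) [0..<n] @ [0..<n]"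

definition isolated :: "nat \<Rightarrow> history \<Rightarrow> nat \<Rightarrow> bool" where
  "isolated n h v \<longleftrightarrow> v \<notin> \<Union> (unclaimed n h)"

text \<open>A vertex isolated further down the queue counts as live until the queue reaches it, so
  deaths always occur in an initial segment. The default \<open>current s\<close> occurs only when
  every queue entry is isolated.\<close>

definition advance :: "nat \<Rightarrow> state \<Rightarrow> history \<Rightarrow> nat set \<times> nat set set \<Rightarrow> state" where
  "advance n s h r = State (leaves_after s h (fst r)) (urgent_after s h (fst r))
     (dead s \<union> set (takeWhile (isolated n (h @ [r])) (queue n s h (fst r))))
     (case dropWhile (isolated n (h @ [r])) (queue n s h (fst r)) of [] \<Rightarrow> current s | x # _ \<Rightarrow> x)"

text \<open>A strategy sees only the history, so the bookkeeping is recomputed from it; the fold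
  carries along the prefix that \<open>advance\<close> needs.\<close>

definition state_of :: "nat \<Rightarrow> history \<Rightarrow> state" where
  "state_of n h = snd (foldl (\<lambda>(g, s) r. (g @ [r], advance n s g r)) ([], State {} {} {} 0) h)"

lemma state_of_Nil [simp]: "state_of n [] = State {} {} {} 0"
  by (simp add: state_of_def)

lemma state_of_snoc: "state_of n (h @ [r]) = advance n (state_of n h) h r"
proof -
  have "fst (foldl (\<lambda>(g, s) r. (g @ [r], advance n s g r)) ([], State {} {} {} 0) h) = h"
    by (induction h rule: rev_induct) (auto simp: case_prod_beta)
  then show ?thesis
    by (simp add: state_of_def case_prod_beta)
qed

definition kill_strategy :: "nat \<Rightarrow> nat \<Rightarrow> strategy" where
  "kill_strategy n b h e = serve b (unclaimed n h - {e}) (queue n (state_of n h) h e)"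

lemma breaker_strategy_kill_strategy: "breaker_strategy n b (kill_strategy n b)"
  by (simp add: breaker_strategy_def kill_strategy_def serve_subset card_serve finite_unclaimed)

section \<open>Histories of plays against this strategy\<close>

inductive consistent :: "nat \<Rightarrow> nat \<Rightarrow> history \<Rightarrow> bool" for n b where
  Nil: "consistent n b []"
| snoc: "consistent n b h \<Longrightarrow> e \<in> unclaimed n h \<Longrightarrow> consistent n b (h @ [(e, kill_strategy n b h e)])"

lemma consistent_snocD:
  assumes "consistent n b (h @ [r])"
  shows "consistent n b h" "fst r \<in> unclaimed n h" "snd r = kill_strategy n b h (fst r)"
  using assms by (auto elim: consistent.cases)

lemma consistent_take: "consistent n b h \<Longrightarrow> consistent n b (take i h)"
proof (induction rule: consistent.induct)
  case Nil
  then show ?case by (simp add: consistent.Nil)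
next
  case (snoc h e)
  then show ?case by (cases "i \<le> length h") (auto intro: consistent.intros)
qed

lemma consistent_nth:
  assumes "consistent n b h" "i < length h"
  shows "fst (h ! i) \<in> unclaimed n (take i h)"
    and "take (Suc i) h = take i h @ [(fst (h ! i), kill_strategy n b (take i h) (fst (h ! i)))]"
proof -
  have eq: "take (Suc i) h = take i h @ [h ! i]"
    using assms(2) by (rule take_Suc_conv_app_nth)
  have "consistent n b (take i h @ [h ! i])"
    using consistent_take[OF assms(1), of "Suc i"] eq by simp
  note c = consistent_snocD[OF this]
  show "fst (h ! i) \<in> unclaimed n (take i h)"
    by (rule c(2))
  show "take (Suc i) h = take i h @ [(fst (h ! i), kill_strategy n b (take i h) (fst (h ! i)))]"
    using eq c(3) by (metis prod.collapse)
qed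

lemma consistent_play_rounds:
  "h \<in> set_pmf (play_rounds n (kill_strategy n b) t) \<Longrightarrow> consistent n b h"
proof (induction t arbitrary: h)
  case 0
  then show ?case by (simp add: consistent.Nil)
next
  case (Suc t)
  then obtain g where g: "consistent n b g" "h \<in> set_pmf (play_round n (kill_strategy n b) g)"
    by auto
  then show ?case
    by (auto simp: play_round_def finite_unclaimed intro: consistent.snoc split: if_splits)
qed

lemma maker_edges_snoc: "maker_edges (h @ [r]) = insert (fst r) (maker_edges h)"
  by (auto simp: maker_edges_def)

lemma unclaimed_snoc: "unclaimed n (h @ [(e, R)]) = unclaimed n h - {e} - R"
  by (auto simp: unclaimed_def maker_edges_def breaker_edges_def)

lemma unclaimed_edge:
  assumes "e \<in> unclaimed n h"
  obtains u v where "e = {u, v}" "u \<noteq> v" "u < n" "v < n"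
  using assms by (auto simp: unclaimed_def complete_graph_def card_2_iff)

lemma state_snoc:
  shows "leaves (state_of n (h @ [(e, R)])) = leaves_after (state_of n h) h e"
    and "urgent (state_of n (h @ [(e, R)])) = urgent_after (state_of n h) h e"
    and "dead (state_of n (h @ [(e, R)])) = dead (state_of n h)
      \<union> set (takeWhile (isolated n (h @ [(e, R)])) (queue n (state_of n h) h e))"
    and "current (state_of n (h @ [(e, R)])) =
      (case dropWhile (isolated n (h @ [(e, R)])) (queue n (state_of n h) h e) of
        [] \<Rightarrow> current (state_of n h) | x # _ \<Rightarrow> x)"
  by (simp_all add: state_of_snoc advance_def)

section \<open>Invariants of the game\<close>

lemma dead_isolated: "v \<in> dead (state_of n h) \<Longrightarrow> e \<in> unclaimed n h \<Longrightarrow> v \<notin> e"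
proof (induction h rule: rev_induct)
  case Nil
  then show ?case by simp
next
  case (snoc r h)
  obtain f R where r: "r = (f, R)" by force
  have "e \<in> unclaimed n h" using snoc.prems(2) by (simp add: r unclaimed_snoc)
  then show ?case
    using snoc by (auto simp: r state_snoc isolated_def dest!: set_takeWhileD)
qed

lemma dead_mono_snoc: "dead (state_of n h) \<subseteq> dead (state_of n (h @ [r]))"
  by (cases r) (simp add: state_snoc)

lemma urgent_mono_snoc: "urgent (state_of n h) \<subseteq> urgent (state_of n (h @ [r]))"
  by (cases r) (auto simp: state_snoc urgent_after_def)

lemma leaves_mono_snoc: "leaves (state_of n h) \<subseteq> leaves (state_of n (h @ [r]))"
  by (cases r) (auto simp: state_snoc leaves_after_def)

lemma take_mono_of_snoc:
  assumes "\<And>h r. F h \<subseteq> F (h @ [r])" and "i \<le> j"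
  shows "F (take i h) \<subseteq> F (take j h)"
  using assms(2)
proof (induction j rule: dec_induct)
  case (step j)
  then show ?case
    using assms(1)[of "take j h" "h ! j"]
    by (cases "j < length h") (auto simp: take_Suc_conv_app_nth)
qed simp

lemmas dead_mono = take_mono_of_snoc[of "\<lambda>h. dead (state_of n h)" for n, OF dead_mono_snoc]
lemmas urgent_mono = take_mono_of_snoc[of "\<lambda>h. urgent (state_of n h)" for n, OF urgent_mono_snoc]
lemmas leaves_mono = take_mono_of_snoc[of "\<lambda>h. leaves (state_of n h)" for n, OF leaves_mono_snoc]

lemma maker_edges_nth: "i < length h \<Longrightarrow> i < j \<Longrightarrow> fst (h ! i) \<in> maker_edges (take j h)"
  by (force simp: maker_edges_def in_set_conv_nth)

section \<open>Components of Maker's graph\<close>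

lemma component_refl: "v \<in> component M v"
  by (simp add: component_def)

lemma component_closed: "x \<in> component M v \<Longrightarrow> {x, y} \<in> M \<Longrightarrow> y \<in> component M v"
  by (auto simp: component_def intro: rtrancl_into_rtrancl)

lemma component_least:
  assumes "v \<in> X" "\<And>x y. x \<in> X \<Longrightarrow> {x, y} \<in> M \<Longrightarrow> y \<in> X"
  shows "component M v \<subseteq> X"
proof
  fix w assume "w \<in> component M v"
  then have "(v, w) \<in> {(x, y). {x, y} \<in> M}\<^sup>*" by (simp add: component_def)
  then show "w \<in> X" by induction (use assms in auto)
qed

lemma new_leaf:
  assumes "star_move s h e"
  shows "new_leaf h e \<in> e" "fresh h (new_leaf h e)"
proof -
  obtain v where "v \<in> e \<and> fresh h v" using assms by (auto simp: star_move_def)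
  then show "new_leaf h e \<in> e" "fresh h (new_leaf h e)"
    using LeastI[of "\<lambda>v. v \<in> e \<and> fresh h v" v] by (simp_all add: new_leaf_def)
qed

text \<open>A dangerous move adds whole components and joins only vertices that are urgent
  afterwards; a star move has no urgent end.\<close>

lemma urgent_closed:
  "x \<in> urgent (state_of n h) \<Longrightarrow> {x, y} \<in> maker_edges h \<Longrightarrow> y \<in> urgent (state_of n h)"
proof (induction h arbitrary: x y rule: rev_induct)
  case Nil
  then show ?case by simp
next
  case (snoc r h)
  obtain e R where r: "r = (e, R)" by force
  show ?case
  proof (cases "star_move (state_of n h) h e")
    case True
    then have "x \<notin> e" using snoc.prems(1) by (auto simp: r state_snoc urgent_after_def star_move_def clean_def)
    then show ?thesis using snoc True by (auto simp: r state_snoc urgent_after_def maker_edges_snoc)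
  next
    case False
    show ?thesis
    proof (cases "{x, y} = e")
      case True
      then show ?thesis
        using False component_refl by (auto simp: r state_snoc urgent_after_def)
    next
      case F: False
      then have "{x, y} \<in> maker_edges h" using snoc.prems(2) by (auto simp: r maker_edges_snoc)
      then show ?thesis
        using snoc.prems(1) snoc.IH False component_closed
        by (auto simp: r state_snoc urgent_after_def) blast
    qed
  qed
qed

lemma component_urgent:
  "v \<in> urgent (state_of n h) \<Longrightarrow> component (maker_edges h) v \<subseteq> urgent (state_of n h)"
  using urgent_closed by (intro component_least) auto

text \<open>Outside the urgent vertices Maker's components are stars whose leaves were condemned, with at
  most one leaf not yet dead.\<close>

lemma star_structure:
  assumes "consistent n b h"
  defines "s \<equiv> state_of n h"
  shows "(\<forall>u v. {u, v} \<in> maker_edges h \<longrightarrow> v \<notin> urgent s \<longrightarrow> (u \<in> leaves s) \<noteq> (v \<in> leaves s)) \<and>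
    (\<forall>q\<in>leaves s - urgent s. \<exists>!u. {q, u} \<in> maker_edges h) \<and>
    (\<forall>v w w'. v \<notin> urgent s \<longrightarrow> v \<notin> leaves s \<longrightarrow> {v, w} \<in> maker_edges h \<longrightarrow> {v, w'} \<in> maker_edges h
       \<longrightarrow> w \<notin> dead s \<longrightarrow> w' \<notin> dead s \<longrightarrow> w = w')"
  using assms(1) unfolding s_def
proof (induction rule: consistent.induct)
  case Nil
  then show ?case by (simp add: maker_edges_def)
next
  case (snoc h e)
  let ?s = "state_of n h" and ?h' = "h @ [(e, kill_strategy n b h e)]"
  let ?s' = "state_of n ?h'"
  note IH = snoc.IH
  note A0 = IH[THEN conjunct1, rule_format] and B0 = IH[THEN conjunct2, THEN conjunct1, rule_format]
    and C0 = IH[THEN conjunct2, THEN conjunct2, rule_format]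
  have dead: "dead ?s \<subseteq> dead ?s'" by (rule dead_mono_snoc)
  obtain u v where uv: "e = {u, v}" "u \<noteq> v" using snoc.hyps(2) by (rule unclaimed_edge)
  show ?case
  proof (cases "star_move ?s h e")
    case False
    have u': "urgent ?s' = urgent_after ?s h e" "leaves ?s' = leaves ?s"
      using False by (simp_all add: state_snoc leaves_after_def)
    have e: "e \<subseteq> urgent ?s'" "urgent ?s \<subseteq> urgent ?s'"
      using False component_refl by (auto simp: u' urgent_after_def)
    \<comment> \<open>Both ends of a dangerous edge are urgent from now on, so a vertex that stays
      outside the urgent set gains no edge.\<close>
    have edge: "{x, y} \<in> maker_edges ?h' \<longleftrightarrow> {x, y} \<in> maker_edges h" if "y \<notin> urgent ?s'" for x y
      using that e by (auto simp: maker_edges_snoc)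
    have edge': "{y, x} \<in> maker_edges ?h' \<longleftrightarrow> {y, x} \<in> maker_edges h" if "y \<notin> urgent ?s'" for x y
      using edge[OF that] by (simp add: insert_commute)
    have A: "(x \<in> leaves ?s') \<noteq> (y \<in> leaves ?s')" if "{x, y} \<in> maker_edges ?h'" "y \<notin> urgent ?s'" for x y
      using A0[of x y] that e(2) edge by (auto simp: u'(2))
    have B: "\<exists>!x. {q, x} \<in> maker_edges ?h'" if "q \<in> leaves ?s' - urgent ?s'" for q
    proof -
      have "q \<in> leaves ?s - urgent ?s" using that e(2) by (auto simp: u'(2))
      then show ?thesis using B0[of q] edge' that by simp
    qed
    have C: "w = w'" if "v \<notin> urgent ?s'" "v \<notin> leaves ?s'" "{v, w} \<in> maker_edges ?h'"
        "{v, w'} \<in> maker_edges ?h'" "w \<notin> dead ?s'" "w' \<notin> dead ?s'" for v w w'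
      using that e(2) dead edge' by (intro C0[of v w w']) (auto simp: u'(2))
    show ?thesis using A B C by blast
  next
    case True
    define l where "l = new_leaf h e"
    have l: "l \<in> e" "fresh h l" using new_leaf[OF True] by (simp_all add: l_def)
    obtain c where c: "e = {c, l}" "c \<noteq> l" using uv l(1) by auto
    have cl: "clean ?s h c" using True c by (auto simp: star_move_def)
    have l_cl: "clean ?s h l" using True c by (auto simp: star_move_def)
    have u': "urgent ?s' = urgent ?s" "leaves ?s' = insert l (leaves ?s)"
      using True by (simp_all add: state_snoc leaves_after_def urgent_after_def l_def)
    have m': "maker_edges ?h' = insert {c, l} (maker_edges h)"
      by (simp add: maker_edges_snoc c)
    have nl: "{l, x} \<notin> maker_edges h" "{x, l} \<notin> maker_edges h" for x
      using l(2) by (auto simp: fresh_def)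
    have cq: "c \<notin> leaves ?s" "c \<notin> urgent ?s" "l \<notin> leaves ?s" "l \<notin> urgent ?s"
      using cl l_cl by (auto simp: clean_def)
    \<comment> \<open>By the first invariant all neighbours of the non-leaf \<open>c\<close> are
      leaves, and cleanness makes them dead. Hence \<open>l\<close> will be its only live
      leaf.\<close>
    have nc: "w \<in> dead ?s" if "{c, w} \<in> maker_edges h" for w
    proof (rule ccontr)
      assume "w \<notin> dead ?s"
      moreover have "w \<in> leaves ?s"
        using A0[of w c] that cq by (simp add: insert_commute)
      ultimately show False using cl that by (auto simp: clean_def)
    qed
    have A: "(x \<in> leaves ?s') \<noteq> (y \<in> leaves ?s')" if "{x, y} \<in> maker_edges ?h'" "y \<notin> urgent ?s'" for x y
    proof (cases "{x, y} = {c, l}")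
      case True
      then show ?thesis using cq c(2) by (auto simp: u' doubleton_eq_iff)
    next
      case False
      then have "{x, y} \<in> maker_edges h" using that(1) by (simp add: m')
      moreover have "x \<noteq> l" "y \<noteq> l" using calculation nl by auto
      ultimately show ?thesis using A0[of x y] that(2) by (simp add: u')
    qed
    have B: "\<exists>!x. {q, x} \<in> maker_edges ?h'" if "q \<in> leaves ?s' - urgent ?s'" for q
    proof (cases "q = l")
      case True
      then show ?thesis using nl c(2) by (auto simp: m' doubleton_eq_iff)
    next
      case False
      then have "q \<in> leaves ?s - urgent ?s" "q \<noteq> c" using that cq by (auto simp: u')
      then have "\<exists>!x. {q, x} \<in> maker_edges h" "{q, x} \<noteq> {c, l}" for x
        using B0 False by (auto simp: doubleton_eq_iff)
      then show ?thesis by (simp add: m')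
    qed
    have C: "w = w'" if "v \<notin> urgent ?s'" "v \<notin> leaves ?s'" "{v, w} \<in> maker_edges ?h'"
        "{v, w'} \<in> maker_edges ?h'" "w \<notin> dead ?s'" "w' \<notin> dead ?s'" for v w w'
    proof (cases "v = c")
      case True
      then have "w = l \<or> {c, w} \<in> maker_edges h" "w' = l \<or> {c, w'} \<in> maker_edges h"
        using that(3,4) by (auto simp: m' doubleton_eq_iff)
      then show ?thesis using nc dead that(5,6) by blast
    next
      case False
      then have "{v, w} \<in> maker_edges h" "{v, w'} \<in> maker_edges h"
        using that(2,3,4) by (auto simp: m' u' doubleton_eq_iff)
      then show ?thesis using that dead by (intro C0[of v w w']) (auto simp: u')
    qed
    show ?thesis using A B C by blast
  qed
qed

lemma
  assumes "consistent n b h" "v \<notin> urgent (state_of n h)"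
  shows edge_has_leaf: "{u, v} \<in> maker_edges h \<Longrightarrow> (u \<in> leaves (state_of n h)) \<noteq> (v \<in> leaves (state_of n h))"
    and leaf_has_center: "v \<in> leaves (state_of n h) \<Longrightarrow> \<exists>!u. {v, u} \<in> maker_edges h"
    and unique_live_leaf: "v \<notin> leaves (state_of n h) \<Longrightarrow> {v, w} \<in> maker_edges h \<Longrightarrow>
      {v, w'} \<in> maker_edges h \<Longrightarrow> w \<notin> dead (state_of n h) \<Longrightarrow> w' \<notin> dead (state_of n h) \<Longrightarrow> w = w'"
proof -
  note star = star_structure[OF assms(1)]
  show "(u \<in> leaves (state_of n h)) \<noteq> (v \<in> leaves (state_of n h))" if "{u, v} \<in> maker_edges h"
    using star[THEN conjunct1, rule_format, OF that assms(2)] .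
  show "\<exists>!u. {v, u} \<in> maker_edges h" if "v \<in> leaves (state_of n h)"
    using star[THEN conjunct2, THEN conjunct1] assms(2) that by (simp del: ex_simps)
  show "w = w'" if "v \<notin> leaves (state_of n h)" "{v, w} \<in> maker_edges h"
    "{v, w'} \<in> maker_edges h" "w \<notin> dead (state_of n h)" "w' \<notin> dead (state_of n h)"
    by (rule star[THEN conjunct2, THEN conjunct2, rule_format, OF assms(2) that])
qed

lemma star_component:
  assumes h: "consistent n b h" and m: "m \<notin> urgent (state_of n h)" "m \<notin> leaves (state_of n h)"
  shows "component (maker_edges h) m = insert m {w. {m, w} \<in> maker_edges h}"
proof
  show "component (maker_edges h) m \<subseteq> insert m {w. {m, w} \<in> maker_edges h}"
  proof (rule component_least)
    fix x y assume x: "x \<in> insert m {w. {m, w} \<in> maker_edges h}" and e: "{x, y} \<in> maker_edges h"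
    show "y \<in> insert m {w. {m, w} \<in> maker_edges h}"
    proof (cases "x = m")
      case False
      then have mx: "{x, m} \<in> maker_edges h" using x by (simp add: insert_commute)
      then have "x \<in> leaves (state_of n h)" using edge_has_leaf[OF h m(1)] m(2) by blast
      moreover have "x \<notin> urgent (state_of n h)" using m(1) urgent_closed mx by blast
      ultimately have "y = m" using leaf_has_center[OF h] mx e by blast
      then show ?thesis by simp
    qed (use e in auto)
  qed simp
  show "insert m {w. {m, w} \<in> maker_edges h} \<subseteq> component (maker_edges h) m"
    using component_closed[OF component_refl] component_refl by auto
qed

lemma component_center:
  assumes h: "consistent n b h" and v: "v \<notin> urgent (state_of n h)"
  obtains m where "m \<notin> urgent (state_of n h)" "m \<notin> leaves (state_of n h)"
    "component (maker_edges h) v \<subseteq> component (maker_edges h) m"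
proof (cases "v \<in> leaves (state_of n h)")
  case False
  then show ?thesis using that v by blast
next
  case True
  then obtain m where m: "{v, m} \<in> maker_edges h" using leaf_has_center[OF h v] by blast
  then have "m \<notin> leaves (state_of n h)" using edge_has_leaf[OF h v, of m] True by (simp add: insert_commute)
  moreover have "m \<notin> urgent (state_of n h)" using v m urgent_closed by (metis insert_commute)
  moreover have "component (maker_edges h) v \<subseteq> component (maker_edges h) m"
    using component_closed[OF component_refl, of m v "maker_edges h"] m component_closed
    by (intro component_least) (auto simp: insert_commute)
  ultimately show ?thesis using that by blast
qed

lemma state_bounds:
  assumes "consistent n b h" "n > 0"
  shows "leaves (state_of n h) \<subseteq> {..<n} \<and> urgent (state_of n h) \<subseteq> {..<n} \<and> dead (state_of n h) \<subseteq> {..<n}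
    \<and> current (state_of n h) < n \<and> maker_edges h \<subseteq> snd (complete_graph n)"
  using assms(1)
proof (induction rule: consistent.induct)
  case Nil
  then show ?case using assms(2) by (simp add: maker_edges_def)
next
  case (snoc h e)
  let ?s = "state_of n h" and ?h' = "h @ [(e, kill_strategy n b h e)]"
  have e: "e \<subseteq> {..<n}" "e \<in> snd (complete_graph n)"
    using snoc.hyps(2) by (auto simp: unclaimed_def complete_graph_def)
  have comp: "component (maker_edges h) v \<subseteq> {..<n}" if "v < n" for v
    using snoc.IH that by (intro component_least) (auto simp: complete_graph_def)
  have q: "set (queue n ?s h e) \<subseteq> {..<n}"
    using snoc.IH by (auto simp: queue_def)
  have "current (state_of n ?h') < n"
  proof (cases "dropWhile (isolated n ?h') (queue n ?s h e)")
    case Nil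
    then show ?thesis using snoc.IH by (simp only: state_snoc) simp
  next
    case (Cons x xs)
    then have "x \<in> set (queue n ?s h e)" by (metis list.set_intros(1) set_dropWhileD)
    then have "x < n" using q by auto
    then show ?thesis using Cons by (simp add: state_snoc)
  qed
  moreover have "dead (state_of n ?h') \<subseteq> {..<n}"
  proof -
    have "set (takeWhile (isolated n ?h') (queue n ?s h e)) \<subseteq> {..<n}"
      using q by (auto dest: set_takeWhileD)
    then show ?thesis
      using snoc.IH by (simp only: state_snoc Un_subset_iff)
  qed
  moreover have "leaves (state_of n ?h') \<subseteq> {..<n}"
    using snoc.IH new_leaf(1)[of ?s h e] e by (auto simp: state_snoc leaves_after_def)
  moreover have "urgent (state_of n ?h') \<subseteq> {..<n}"
    using snoc.IH comp e by (auto simp: state_snoc urgent_after_def)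
  moreover have "maker_edges ?h' \<subseteq> snd (complete_graph n)"
    using snoc.IH e by (simp add: maker_edges_snoc)
  ultimately show ?case by simp
qed

text \<open>Such a component is a star with at most one live leaf. Only its centre is not condemned,
  and a clean vertex is a centre without live leaves.\<close>

lemma card_live_component:
  assumes h: "consistent n b h" "n > 0" and v: "v \<notin> urgent (state_of n h)"
  shows "card (component (maker_edges h) v - dead (state_of n h)) \<le> 2"
    and "card (component (maker_edges h) v - leaves (state_of n h) - dead (state_of n h)) \<le> 1"
    and "clean (state_of n h) h v \<Longrightarrow> card (component (maker_edges h) v - dead (state_of n h)) \<le> 1"
proof -
  let ?s = "state_of n h" and ?C = "component (maker_edges h)"
  obtain m where m: "m \<notin> urgent ?s" "m \<notin> leaves ?s" "?C v \<subseteq> ?C m"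
    using component_center[OF h(1) v] by blast
  note C = star_component[OF h(1) m(1,2)]
  have nb: "w \<in> leaves ?s" if "{m, w} \<in> maker_edges h" for w
    using edge_has_leaf[OF h(1) m(1), of w] that m(2) by (simp add: insert_commute)
  obtain x where x: "{w. {m, w} \<in> maker_edges h} - dead ?s \<subseteq> {x}"
    using unique_live_leaf[OF h(1) m(1,2)] by blast
  have "card (?C v - dead ?s) \<le> card {m, x}"
    using m(3) C x by (intro card_mono) auto
  also have "\<dots> \<le> 2" by (simp add: card_insert_if)
  finally show "card (?C v - dead ?s) \<le> 2" .
  have "card (?C v - leaves ?s - dead ?s) \<le> card {m}"
    using m(3) C nb by (intro card_mono) auto
  then show "card (?C v - leaves ?s - dead ?s) \<le> 1" by simp
  assume cl: "clean ?s h v"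
  then have v': "v \<notin> leaves ?s" by (simp add: clean_def)
  note C = star_component[OF h(1) v v']
  have nb: "w \<in> leaves ?s" if "{v, w} \<in> maker_edges h" for w
    using edge_has_leaf[OF h(1) v, of w] that v' by (simp add: insert_commute)
  have "?C v - dead ?s \<subseteq> {v}"
    using cl nb by (auto simp: C clean_def)
  then show "card (?C v - dead ?s) \<le> 1"
    using card_mono[of "{v}"] by fastforce
qed

section \<open>Counting\<close>

abbreviation backlog :: "state \<Rightarrow> nat set" where
  "backlog s \<equiv> leaves s \<union> urgent s"

abbreviation live :: "nat \<Rightarrow> state \<Rightarrow> nat set" where
  "live n s \<equiv> {..<n} - dead s"

lemma
  assumes "consistent n b h" "n > 0"
  shows leaves_bound: "leaves (state_of n h) \<subseteq> {..<n}"
    and urgent_bound: "urgent (state_of n h) \<subseteq> {..<n}"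
    and dead_bound: "dead (state_of n h) \<subseteq> {..<n}"
    and current_bound: "current (state_of n h) < n"
    and maker_edges_bound: "maker_edges h \<subseteq> snd (complete_graph n)"
  using state_bounds[OF assms] by simp_all

lemma finite_component:
  assumes "consistent n b h" "n > 0" "v < n"
  shows "finite (component (maker_edges h) v)"
proof -
  have "component (maker_edges h) v \<subseteq> {..<n}"
    using maker_edges_bound[OF assms(1,2)] assms(3)
    by (intro component_least) (auto simp: complete_graph_def)
  then show ?thesis by (rule finite_subset) simp
qed

lemma card_UN_pair:
  assumes "u \<noteq> v" "card (f u) \<le> k" "card (f v) \<le> k"
  shows "card (\<Union>x\<in>{u, v}. f x) \<le> 2 * k"
  using card_Un_le[of "f u" "f v"] assms by auto

text \<open>A dangerous move makes at most two components urgent, each with one live vertex if its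
  end is clean and two otherwise; an already urgent component adds nothing, as \<open>urgent\<close>
  is closed. For the backlog only the centres are new, the leaves having been condemned
  before.\<close>

lemma card_new_urgent:
  assumes h: "consistent n b h" "n > 0" and e: "e \<in> unclaimed n h"
  defines "s \<equiv> state_of n h"
  shows "card (urgent_after s h e - urgent s - dead s) \<le> 2 * of_bool (\<not> star_move s h e) + 2 * of_bool (\<not> (\<forall>v\<in>e. clean s h v))"
    and "card (urgent_after s h e - urgent s - dead s) \<le> 2 + 2 * of_bool (\<not> (\<forall>v\<in>e. clean s h v))"
    and "card ((leaves_after s h e \<union> urgent_after s h e) - backlog s - dead s) \<le> 1 + of_bool (\<not> star_move s h e)"
proof -
  obtain u v where uv: "e = {u, v}" "u \<noteq> v" "u < n" "v < n"
    using e by (rule unclaimed_edge)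
  let ?C = "component (maker_edges h)"
  have fin: "finite (?C x)" if "x \<in> {u, v}" for x
    using finite_component[OF h] uv that by auto
  define f where "f x = (if x \<in> urgent s then {} else ?C x - dead s)" for x
  have sub: "urgent_after s h e - urgent s - dead s \<subseteq> (\<Union>x\<in>{u, v}. f x)"
    using component_urgent[of _ n h] by (auto simp: urgent_after_def f_def uv(1) s_def split: if_splits)
  have fin_f: "finite (\<Union>x\<in>{u, v}. f x)"
    using fin by (auto simp: f_def)
  have f2: "card (f x) \<le> 2" for x
    using card_live_component(1)[OF h, of x] by (auto simp: f_def s_def)
  have f1: "card (f x) \<le> 1" if "clean s h x" for x
    using card_live_component(3)[OF h, of x] that by (auto simp: f_def s_def)
  have four: "card (urgent_after s h e - urgent s - dead s) \<le> 2 * 2"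
    using card_mono[OF fin_f sub] card_UN_pair[where f = f, OF uv(2) f2 f2] by linarith
  have two: "card (urgent_after s h e - urgent s - dead s) \<le> 2 * 1" if "\<forall>v\<in>e. clean s h v"
    using card_mono[OF fin_f sub] card_UN_pair[where f = f, OF uv(2) f1 f1] that uv(1) by fastforce
  have zero: "card (urgent_after s h e - urgent s - dead s) = 0" if "star_move s h e"
    using that by (simp add: urgent_after_def)
  show "card (urgent_after s h e - urgent s - dead s) \<le> 2 * of_bool (\<not> star_move s h e) + 2 * of_bool (\<not> (\<forall>v\<in>e. clean s h v))"
  proof (cases "star_move s h e")
    case True
    then show ?thesis using zero by simp
  next
    case False
    then show ?thesis using two four by (cases "\<forall>v\<in>e. clean s h v") (simp_all del: ball_simps)
  qed
  show "card (urgent_after s h e - urgent s - dead s) \<le> 2 + 2 * of_bool (\<not> (\<forall>v\<in>e. clean s h v))"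
    using two four by (cases "\<forall>v\<in>e. clean s h v") (simp_all del: ball_simps)
  show "card ((leaves_after s h e \<union> urgent_after s h e) - backlog s - dead s) \<le> 1 + of_bool (\<not> star_move s h e)"
  proof (cases "star_move s h e")
    case True
    have "card ((leaves_after s h e \<union> urgent_after s h e) - backlog s - dead s) \<le> card {new_leaf h e}"
      using True by (intro card_mono) (auto simp: leaves_after_def urgent_after_def)
    then show ?thesis by simp
  next
    case False
    define g where "g x = (if x \<in> urgent s then {} else ?C x - leaves s - dead s)" for x
    have sub: "(leaves_after s h e \<union> urgent_after s h e) - backlog s - dead s \<subseteq> (\<Union>x\<in>{u, v}. g x)"
      using component_urgent[of _ n h] False
      by (auto simp: leaves_after_def urgent_after_def g_def uv(1) s_def split: if_splits)
    have fin_g: "finite (\<Union>x\<in>{u, v}. g x)"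
      using fin by (auto simp: g_def)
    have g1: "card (g x) \<le> 1" for x
      using card_live_component(2)[OF h, of x] by (auto simp: g_def s_def)
    show ?thesis
      using card_mono[OF fin_g sub] card_UN_pair[where f = g, OF uv(2) g1 g1] False by simp
  qed
qed

text \<open>While enough edges remain, Breaker's reply has exactly \<open>b\<close> edges, so the
  number of unclaimed edges depends on the time alone. This makes a deterministic clock
  possible.\<close>

lemma card_unclaimed:
  assumes "consistent n b h" "(b + 1) * length h \<le> n choose 2"
  shows "card (unclaimed n h) + (b + 1) * length h = n choose 2"
  using assms
proof (induction rule: consistent.induct)
  case Nil
  have "card {e. e \<subseteq> {..<n} \<and> card e = 2} = n choose 2"
    using n_subsets[of "{..<n}" 2] by simp
  then show ?case by (simp add: unclaimed_def maker_edges_def breaker_edges_def complete_graph_def)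
next
  case (snoc h e)
  let ?A = "unclaimed n h - {e}"
  have IH: "card (unclaimed n h) + (b + 1) * length h = n choose 2"
    using snoc by simp
  have A: "card ?A = card (unclaimed n h) - 1" "card (unclaimed n h) > 0"
    using snoc.hyps(2) finite_unclaimed by (auto simp: card_gt_0_iff)
  have fin: "finite ?A" by (simp add: finite_unclaimed)
  have "card (unclaimed n h) \<ge> b + 1"
    using IH snoc.prems by simp
  then have "card (kill_strategy n b h e) = b"
    using A by (simp add: kill_strategy_def card_serve[OF fin])
  then have "card (?A - kill_strategy n b h e) = card ?A - b"
    using serve_subset[OF fin] fin
    by (subst card_Diff_subset) (auto simp: kill_strategy_def intro: finite_subset)
  then show ?case
    using IH A \<open>card (unclaimed n h) \<ge> b + 1\<close> by (simp add: unclaimed_snoc)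
qed

section \<open>Rounds in which Breaker is busy with condemned vertices\<close>

lemma takeWhile_prefix:
  assumes "x \<in> set ys" "\<not> P x"
  obtains z zs' where "dropWhile P (ys @ zs) = z # zs'" "z \<in> set ys" "set (takeWhile P (ys @ zs)) \<subseteq> set ys" "\<not> P z"
proof -
  have tw: "takeWhile P (ys @ zs) = takeWhile P ys"
    using assms by (rule takeWhile_append1)
  have dw: "dropWhile P (ys @ zs) = dropWhile P ys @ zs"
    using assms by (rule dropWhile_append1)
  have "dropWhile P ys \<noteq> []"
    using assms by auto
  then obtain z zs' where z: "dropWhile P ys = z # zs'" by (cases "dropWhile P ys") auto
  then have "\<not> P z" by (metis hd_dropWhile list.distinct(1) list.sel(1))
  moreover have "z \<in> set ys" using z by (metis list.set_intros(1) set_dropWhileD)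
  ultimately show ?thesis
    using that z tw dw by (auto dest: set_takeWhileD)
qed

text \<open>Together with \<open>current s\<close>, the set \<open>X\<close> forms an initial
  segment of the queue. If \<open>X\<close> still has a live vertex after the reply, some entry of
  this segment is not isolated, so the queue stops there and nothing outside the segment is finished
  in this round.\<close>

lemma busy_aux:
  assumes h: "consistent n b h" "n > 0" and e: "e \<in> unclaimed n h"
  defines "h' \<equiv> h @ [(e, kill_strategy n b h e)]"
  defines "s \<equiv> state_of n h" and "s' \<equiv> state_of n h'"
  assumes X: "X = urgent s' \<or> X = backlog s'" and busy: "X - dead s' \<noteq> {}"
  obtains z zs where "dropWhile (isolated n h') (queue n s h e) = z # zs" "z \<in> insert (current s) X"
    "set (takeWhile (isolated n h') (queue n s h e)) \<subseteq> insert (current s) X" "\<not> isolated n h' z"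
proof -
  have h': "consistent n b h'" unfolding h'_def using h e by (intro consistent.snoc)
  have s': "leaves s' = leaves_after s h e" "urgent s' = urgent_after s h e"
    by (simp_all add: s'_def h'_def state_snoc s_def)
  have d: "dead s' = dead s \<union> set (takeWhile (isolated n h') (queue n s h e))"
    by (simp add: s'_def h'_def state_snoc s_def)
  have b: "leaves s' \<subseteq> {..<n}" "urgent s' \<subseteq> {..<n}"
    using leaves_bound[OF h' h(2)] urgent_bound[OF h' h(2)] by (simp_all add: s'_def)
  obtain ys zs where q: "queue n s h e = (current s # ys) @ zs" "set ys = X"
  proof (cases "X = urgent s'")
    case True
    then show ?thesis
      using b by (intro that[of "filter (\<lambda>v. v \<in> urgent s') [0..<n]"]) (auto simp: queue_def s')
  next
    case False
    then have "X = backlog s'" using X by simp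
    then show ?thesis
      using b by (intro that[of "filter (\<lambda>v. v \<in> urgent s') [0..<n] @ filter (\<lambda>v. v \<in> leaves s') [0..<n]"])
        (auto simp: queue_def s')
  qed
  have "\<exists>x\<in>set (current s # ys). \<not> isolated n h' x"
  proof (rule ccontr)
    assume "\<not> ?thesis"
    then have "set (current s # ys) \<subseteq> set (takeWhile (isolated n h') ((current s # ys) @ zs))"
      by (subst takeWhile_append2) auto
    then show False using busy q d by auto
  qed
  then obtain x where "x \<in> set (current s # ys)" "\<not> isolated n h' x" by blast
  then obtain z zs' where "dropWhile (isolated n h') ((current s # ys) @ zs) = z # zs'"
    "z \<in> set (current s # ys)"
    "set (takeWhile (isolated n h') ((current s # ys) @ zs)) \<subseteq> set (current s # ys)" "\<not> isolated n h' z"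
    by (rule takeWhile_prefix[where P = "isolated n h'"])
  then show ?thesis
    using q by (intro that[of z zs']) (simp_all only: q list.set not_False_eq_True)
qed

lemma busy_step:
  assumes h: "consistent n b h" "n > 0" and e: "e \<in> unclaimed n h"
  defines "s \<equiv> state_of n h" and "s' \<equiv> state_of n (h @ [(e, kill_strategy n b h e)])"
  assumes X: "X = urgent s' \<or> X = backlog s'" and busy: "X - dead s' \<noteq> {}"
  shows "dead s' - dead s \<subseteq> insert (current s) X" "current s' \<in> insert (current s) X"
proof -
  obtain z zs where z: "dropWhile (isolated n (h @ [(e, kill_strategy n b h e)])) (queue n s h e) = z # zs"
    "z \<in> insert (current s) X"
    "set (takeWhile (isolated n (h @ [(e, kill_strategy n b h e)])) (queue n s h e)) \<subseteq> insert (current s) X"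
    using busy_aux[OF h e X[unfolded s'_def] busy[unfolded s'_def]] unfolding s_def by metis
  then show "dead s' - dead s \<subseteq> insert (current s) X" "current s' \<in> insert (current s) X"
    by (auto simp: s'_def s_def state_snoc)
qed

text \<open>Both ends of an unclaimed edge are live, so the edge comes from a pair of a live vertex
  of \<open>X\<close> and a live vertex.\<close>

lemma card_edges_touching:
  assumes "dead (state_of n h) \<subseteq> {..<n}" "X \<subseteq> {..<n}"
  shows "card {e \<in> unclaimed n h. e \<inter> X \<noteq> {}} \<le> card (X - dead (state_of n h)) * card (live n (state_of n h))"
proof -
  let ?D = "dead (state_of n h)"
  have "{e \<in> unclaimed n h. e \<inter> X \<noteq> {}} \<subseteq> (\<lambda>(u, v). {u, v}) ` ((X - ?D) \<times> live n (state_of n h))"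
  proof
    fix e assume e: "e \<in> {e \<in> unclaimed n h. e \<inter> X \<noteq> {}}"
    then have "e \<in> unclaimed n h" by simp
    then obtain u v where uv: "e = {u, v}" "u < n" "v < n" by (rule unclaimed_edge)
    have "u \<notin> ?D" "v \<notin> ?D" using dead_isolated e uv by blast+
    moreover have "u \<in> X \<or> v \<in> X" using e uv by auto
    ultimately show "e \<in> (\<lambda>(u, v). {u, v}) ` ((X - ?D) \<times> live n (state_of n h))"
      using uv by (auto simp: image_iff insert_commute)
  qed
  then have "card {e \<in> unclaimed n h. e \<inter> X \<noteq> {}} \<le> card ((X - ?D) \<times> live n (state_of n h))"
    using assms(2) by (intro surj_card_le) (auto intro: finite_subset)
  then show ?thesis by (simp add: card_cartesian_product)
qed

lemma card_edges_inside:
  assumes "finite X"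
  shows "card {e \<in> unclaimed n h. e \<subseteq> X} \<le> (card (X - dead (state_of n h))) choose 2"
proof -
  have "{e \<in> unclaimed n h. e \<subseteq> X} \<subseteq> {e. e \<subseteq> X - dead (state_of n h) \<and> card e = 2}"
    using dead_isolated by (auto simp: unclaimed_def complete_graph_def)
  then have "card {e \<in> unclaimed n h. e \<subseteq> X} \<le> card {e. e \<subseteq> X - dead (state_of n h) \<and> card e = 2}"
    using assms by (intro card_mono) auto
  then show ?thesis using n_subsets[of "X - dead (state_of n h)" 2] assms by simp
qed

text \<open>Maker's move condemns at most two live vertices; with \<open>current\<close> these are
  three, and all their unclaimed edges fit into one reply. If one of them survived, the order of
  service would yield \<open>b + 1\<close> edges at these three vertices.\<close>

lemma backlog_stays_empty:
  assumes h: "consistent n b h" "n > 0" and e: "e \<in> unclaimed n h"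
  defines "s \<equiv> state_of n h" and "s' \<equiv> state_of n (h @ [(e, kill_strategy n b h e)])"
  assumes empty: "backlog s \<subseteq> dead s" and small: "3 * card (live n s) \<le> b"
  shows "backlog s' \<subseteq> dead s'"
proof (rule ccontr)
  assume "\<not> backlog s' \<subseteq> dead s'"
  then have busy: "backlog s' - dead s' \<noteq> {}" by blast
  let ?R = "kill_strategy n b h e"
  let ?h' = "h @ [(e, ?R)]"
  have h': "consistent n b ?h'" using h e by (intro consistent.snoc)
  obtain z zs where z: "dropWhile (isolated n ?h') (queue n s h e) = z # zs"
    "z \<in> insert (current s) (backlog s')"
    "set (takeWhile (isolated n ?h') (queue n s h e)) \<subseteq> insert (current s) (backlog s')"
    "\<not> isolated n ?h' z"
    using busy_aux[OF h e disjI2[OF refl] busy[unfolded s'_def]] unfolding s_def s'_def by metis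
  let ?A = "unclaimed n h - {e}" and ?q = "queue n s h e"
  have fin: "finite ?A" by (simp add: finite_unclaimed)
  have R: "?R = serve b ?A ?q" by (simp add: kill_strategy_def s_def)
  have q: "?q = takeWhile (isolated n ?h') ?q @ z # zs"
    by (metis z(1) takeWhile_dropWhile_id)
  obtain g where g: "g \<in> ?A - ?R" "z \<in> g"
    using z(4) by (auto simp: isolated_def unclaimed_snoc)
  let ?X = "insert (current s) (backlog s')"
  have sub: "insert g ?R \<subseteq> {f \<in> unclaimed n h. f \<inter> ?X \<noteq> {}}"
  proof
    fix f assume f: "f \<in> insert g ?R"
    show "f \<in> {f \<in> unclaimed n h. f \<inter> ?X \<noteq> {}}"
    proof (cases "f = g")
      case True
      then show ?thesis using g z(2) by blast
    next
      case False
      then have "f \<in> serve b ?A ?q" using f R by simp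
      moreover have "\<exists>g\<in>?A - serve b ?A ?q. z \<in> g" using g R by auto
      ultimately have "\<exists>v\<in>insert z (set (takeWhile (isolated n ?h') ?q)). v \<in> f"
        by (intro serve_order[OF fin q])
      moreover have "f \<in> unclaimed n h"
        using \<open>f \<in> serve b ?A ?q\<close> serve_subset[OF fin] by blast
      ultimately show ?thesis using z(2,3) by blast
    qed
  qed
  have "\<not> card ?A \<le> b"
  proof
    assume "card ?A \<le> b"
    then have "?R = ?A"
      using card_serve[OF fin, of b ?q] serve_subset[OF fin, of b ?q] fin
      by (metis R card_subset_eq min.absorb2)
    then show False using g by simp
  qed
  then have "card ?R = b" using card_serve[OF fin, of b ?q] R by simp
  moreover have "finite ?R" using R serve_subset[OF fin] fin by (metis finite_subset)
  ultimately have "b + 1 = card (insert g ?R)" using g by simp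
  also have "\<dots> \<le> card {f \<in> unclaimed n h. f \<inter> ?X \<noteq> {}}"
    using sub by (intro card_mono) (auto simp: finite_unclaimed)
  also have "\<dots> \<le> card (?X - dead s) * card (live n s)"
    unfolding s_def
    using dead_bound[OF h] leaves_bound[OF h' h(2)] urgent_bound[OF h' h(2)] current_bound[OF h]
    by (intro card_edges_touching) (auto simp: s'_def)
  also have "\<dots> \<le> 3 * card (live n s)"
  proof (rule mult_le_mono1)
    have "backlog s' - dead s = (leaves_after s h e \<union> urgent_after s h e) - backlog s - dead s"
      using empty by (auto simp: s'_def state_snoc s_def)
    then have "card (backlog s' - dead s) \<le> 2"
      using card_new_urgent(3)[OF h e] by (auto simp: s_def of_bool_def split: if_splits)
    moreover have "finite (backlog s' - dead s)"
      using leaves_bound[OF h' h(2)] urgent_bound[OF h' h(2)] by (auto simp: s'_def intro: finite_subset)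
    moreover have "card (?X - dead s) \<le> card (insert (current s) (backlog s' - dead s))"
      using calculation by (intro card_mono) auto
    ultimately show "card (?X - dead s) \<le> 3"
      using card_insert_le_m1[of 3 "backlog s' - dead s" "current s"] by simp
  qed
  finally show False using small by simp
qed

text \<open>Breaker never leaves more than one vertex partly isolated, so the unclaimed edges nearly form a
  complete graph on the live vertices; this turns the number of rounds into the number of live vertices.\<close>

lemma breaker_edge_current:
  assumes h: "consistent n b h" "n > 0"
  shows "u \<noteq> v \<Longrightarrow> u \<in> live n (state_of n h) \<Longrightarrow> v \<in> live n (state_of n h) \<Longrightarrow>
    {u, v} \<notin> unclaimed n h \<Longrightarrow> {u, v} \<notin> maker_edges h \<Longrightarrow>
    u = current (state_of n h) \<or> v = current (state_of n h)"
  using h(1)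
proof (induction rule: consistent.induct)
  case Nil
  then show ?case by (auto simp: unclaimed_def maker_edges_def breaker_edges_def complete_graph_def)
next
  case (snoc h e)
  let ?R = "kill_strategy n b h e"
  let ?h' = "h @ [(e, ?R)]"
  let ?s = "state_of n h" and ?s' = "state_of n ?h'"
  let ?P = "isolated n ?h'" and ?q = "queue n ?s h e"
  have d: "dead ?s' = dead ?s \<union> set (takeWhile ?P ?q)" by (simp add: state_snoc)
  have live: "u \<in> live n ?s" "v \<in> live n ?s" using snoc.prems d by auto
  have u: "u \<in> set ?q" using live by (simp add: queue_def)
  have "dropWhile ?P ?q \<noteq> []"
  proof
    assume "dropWhile ?P ?q = []"
    then have "takeWhile ?P ?q = ?q" by (metis append.right_neutral takeWhile_dropWhile_id)
    then have "u \<in> dead ?s'" using u d by (metis UnI2)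
    then show False using snoc.prems(2) by simp
  qed
  then obtain z zs where z: "dropWhile ?P ?q = z # zs" by (cases "dropWhile ?P ?q") auto
  have c: "current ?s' = z" using z by (simp add: state_snoc)
  have q: "?q = takeWhile ?P ?q @ z # zs" by (metis z takeWhile_dropWhile_id)
  consider "{u, v} \<in> ?R" | "{u, v} \<notin> unclaimed n h" "{u, v} \<notin> maker_edges h"
    using snoc.prems(4,5) by (auto simp: unclaimed_snoc maker_edges_snoc)
  then show ?case
  proof cases
    case 1
    have "\<not> ?P z" using z by (metis hd_dropWhile list.distinct(1) list.sel(1))
    then have ex: "\<exists>g\<in>(unclaimed n h - {e}) - serve b (unclaimed n h - {e}) ?q. z \<in> g"
      by (auto simp: isolated_def unclaimed_snoc kill_strategy_def)
    have "\<exists>x\<in>insert z (set (takeWhile ?P ?q)). x \<in> {u, v}"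
      using 1 serve_order[OF _ q ex] finite_unclaimed by (auto simp: kill_strategy_def)
    then show ?thesis using snoc.prems(2,3) d c by auto
  next
    case 2
    \<comment> \<open>A vertex that was partly isolated before heads the queue, so it remains
      current unless it has died.\<close>
    then have "u = current ?s \<or> v = current ?s" using snoc.IH snoc.prems(1) live by blast
    then have "current ?s \<notin> dead ?s'" using snoc.prems(2,3) by auto
    then have "\<not> ?P (current ?s)" using d by (auto simp: queue_def)
    then have "current ?s' = current ?s" by (simp add: state_snoc queue_def)
    then show ?thesis using \<open>u = current ?s \<or> v = current ?s\<close> by simp
  qed
qed

lemma card_maker_edges: "card (maker_edges h) \<le> length h"
  unfolding maker_edges_def by (metis card_image_le card_length finite_set order_trans)

text \<open>Between live vertices other than the current one no edge belongs to Breaker, so each is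
  unclaimed or Maker's, and Maker has at most one edge per round.\<close>

lemma card_live_upper:
  assumes h: "consistent n b h" "n > 0"
  shows "(card (live n (state_of n h)) - 1) choose 2 \<le> card (unclaimed n h) + length h"
proof -
  let ?s = "state_of n h"
  let ?Y = "live n ?s - {current ?s}"
  have "{e. e \<subseteq> ?Y \<and> card e = 2} \<subseteq> unclaimed n h \<union> maker_edges h"
    using breaker_edge_current[OF h] by (fastforce simp: card_2_iff)
  then have "card {e. e \<subseteq> ?Y \<and> card e = 2} \<le> card (unclaimed n h \<union> maker_edges h)"
    by (intro card_mono) (auto simp: finite_unclaimed maker_edges_def)
  also have "\<dots> \<le> card (unclaimed n h) + length h"
    using card_Un_le[of "unclaimed n h" "maker_edges h"] card_maker_edges[of h] by linarith
  finally have "card ?Y choose 2 \<le> card (unclaimed n h) + length h"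
    using n_subsets[of ?Y 2] by simp
  moreover have "card (live n ?s) - 1 \<le> card ?Y"
    using card_Diff1_le by (cases "current ?s \<in> live n ?s") simp_all
  ultimately show ?thesis
    using binomial_right_mono[of "card (live n ?s) - 1" "card ?Y" 2] by linarith
qed

lemma card_live_lower:
  "card (unclaimed n h) \<le> card (live n (state_of n h)) choose 2"
proof -
  have "unclaimed n h = {e \<in> unclaimed n h. e \<subseteq> {..<n}}"
    by (auto simp: unclaimed_def complete_graph_def)
  then show ?thesis using card_edges_inside[of "{..<n}" n h] by simp
qed

section \<open>Old vertices and the number of dangerous moves\<close>

lemma finite_not_fresh:
  assumes "consistent n b h" "n > 0"
  shows "finite {v. \<not> fresh h v}"
proof -
  have "e \<subseteq> {..<n}" if "e \<in> maker_edges h" for e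
    using maker_edges_bound[OF assms] that by (auto simp: complete_graph_def)
  then have "\<Union> (maker_edges h) \<subseteq> {..<n}"
    by (rule Union_least)
  moreover have "{v. \<not> fresh h v} = \<Union> (maker_edges h)"
    by (auto simp: fresh_def)
  ultimately show ?thesis
    using finite_subset by (metis finite_lessThan)
qed

text \<open>A star move adds at most its centre, because its leaf is condemned; a dangerous move
  adds nothing, because both ends become urgent.\<close>

lemma card_clean_old:
  assumes h: "consistent n b h" "n > 0"
  shows "card ({v. \<not> fresh h v} - backlog (state_of n h)) \<le> length h"
  using h(1)
proof (induction rule: consistent.induct)
  case Nil
  then show ?case by (simp add: fresh_def maker_edges_def)
next
  case (snoc h e)
  let ?s = "state_of n h" and ?h' = "h @ [(e, kill_strategy n b h e)]"
  let ?s' = "state_of n ?h'"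
  have fr: "{v. \<not> fresh ?h' v} = {v. \<not> fresh h v} \<union> e"
    by (auto simp: fresh_def maker_edges_snoc)
  have "\<exists>x. {v. \<not> fresh ?h' v} - backlog ?s' \<subseteq> insert x ({v. \<not> fresh h v} - backlog ?s)"
  proof (cases "star_move ?s h e")
    case True
    obtain x where "e = {new_leaf h e, x}"
      using unclaimed_edge[OF snoc.hyps(2)] new_leaf(1)[OF True] by (metis insertE insert_commute singletonD)
    then show ?thesis
      using True unfolding fr by (auto simp: state_snoc leaves_after_def urgent_after_def)
  next
    case False
    then have "e \<subseteq> urgent ?s'"
      using component_refl by (auto simp: state_snoc urgent_after_def)
    then show ?thesis
      using leaves_mono_snoc[of n h] urgent_mono_snoc[of n h] unfolding fr by blast
  qed
  then obtain x where x: "{v. \<not> fresh ?h' v} - backlog ?s' \<subseteq> insert x ({v. \<not> fresh h v} - backlog ?s)" by blast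
  note fin = finite_not_fresh[OF snoc.hyps(1) h(2)]
  have "card ({v. \<not> fresh ?h' v} - backlog ?s') \<le> card (insert x ({v. \<not> fresh h v} - backlog ?s))"
    by (rule card_mono[OF _ x]) (simp add: fin)
  also have "\<dots> \<le> Suc (card ({v. \<not> fresh h v} - backlog ?s))"
    using fin by (simp add: card_insert_if)
  finally show ?case using snoc.IH by simp
qed

text \<open>An unclean live vertex outside the backlog is adjacent to a live condemned leaf. That
  leaf has no other neighbour, so charging the vertex to it at most doubles the count.\<close>

lemma card_unclean:
  assumes h: "consistent n b h" "n > 0"
  defines "s \<equiv> state_of n h"
  shows "card ({v. v < n \<and> \<not> clean s h v} - dead s) \<le> 2 * card (backlog s - dead s)"
proof -
  define g where "g q = (THE u. {q, u} \<in> maker_edges h)" for q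
  have fin: "finite (backlog s - dead s)"
    using leaves_bound[OF h] urgent_bound[OF h] by (auto simp: s_def intro: finite_subset)
  have "{v. v < n \<and> \<not> clean s h v} - dead s \<subseteq> (backlog s - dead s) \<union> g ` (backlog s - dead s)"
  proof
    fix v assume v: "v \<in> {v. v < n \<and> \<not> clean s h v} - dead s"
    show "v \<in> (backlog s - dead s) \<union> g ` (backlog s - dead s)"
    proof (cases "v \<in> backlog s")
      case True
      then show ?thesis using v by auto
    next
      case False
      then obtain w where w: "w \<in> leaves s - dead s" "{v, w} \<in> maker_edges h"
        using v by (auto simp: clean_def)
      have "w \<notin> urgent s"
        using False w(2) urgent_closed[of w n h v] by (auto simp: s_def insert_commute)
      then have "\<exists>!u. {w, u} \<in> maker_edges h"
        using leaf_has_center[OF h(1), of w] w by (simp add: s_def)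
      then have "g w = v"
        unfolding g_def using w(2) by (intro the1_equality) (simp_all add: insert_commute)
      then show ?thesis using w(1) by blast
    qed
  qed
  then have "card ({v. v < n \<and> \<not> clean s h v} - dead s) \<le> card ((backlog s - dead s) \<union> g ` (backlog s - dead s))"
    using fin by (intro card_mono) auto
  also have "\<dots> \<le> card (backlog s - dead s) + card (backlog s - dead s)"
    using card_Un_le[of "backlog s - dead s" "g ` (backlog s - dead s)"] card_image_le[OF fin, of g] by linarith
  finally show ?thesis by simp
qed

lemma card_unclean_moves:
  assumes h: "consistent n b h" "n > 0"
  defines "s \<equiv> state_of n h"
  shows "card {e \<in> unclaimed n h. \<not> (\<forall>v\<in>e. clean s h v)} \<le> 2 * card (backlog s - dead s) * card (live n s)"
proof -
  let ?X = "{v. v < n \<and> \<not> clean s h v}"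
  have "{e \<in> unclaimed n h. \<not> (\<forall>v\<in>e. clean s h v)} = {e \<in> unclaimed n h. e \<inter> ?X \<noteq> {}}"
    by (auto simp: unclaimed_def complete_graph_def)
  then have "card {e \<in> unclaimed n h. \<not> (\<forall>v\<in>e. clean s h v)} \<le> card (?X - dead s) * card (live n s)"
    unfolding s_def using dead_bound[OF h] by (auto intro!: card_edges_touching)
  also have "\<dots> \<le> 2 * card (backlog s - dead s) * card (live n s)"
    using card_unclean[OF h] by (intro mult_le_mono1) (simp add: s_def)
  finally show ?thesis .
qed

text \<open>A move between clean vertices is dangerous only if neither end is fresh, and by
  \<open>card_clean_old\<close> at most \<open>length h\<close> vertices can serve as such
  ends.\<close>

lemma card_dangerous_moves:
  assumes h: "consistent n b h" "n > 0"
  defines "s \<equiv> state_of n h"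
  shows "card {e \<in> unclaimed n h. \<not> star_move s h e}
    \<le> (length h choose 2) + 2 * card (backlog s - dead s) * card (live n s)"
proof -
  let ?T = "{v. \<not> fresh h v} - backlog s"
  have fin: "finite ?T"
    using finite_not_fresh[OF h] by simp
  have "{e \<in> unclaimed n h. \<not> star_move s h e} \<subseteq> {e. e \<subseteq> ?T \<and> card e = 2}
      \<union> {e \<in> unclaimed n h. \<not> (\<forall>v\<in>e. clean s h v)}"
    by (auto simp: star_move_def clean_def unclaimed_def complete_graph_def)
  then have "card {e \<in> unclaimed n h. \<not> star_move s h e} \<le> card ({e. e \<subseteq> ?T \<and> card e = 2}
      \<union> {e \<in> unclaimed n h. \<not> (\<forall>v\<in>e. clean s h v)})"
    using fin by (intro card_mono) (auto simp: finite_unclaimed)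
  also have "\<dots> \<le> card {e. e \<subseteq> ?T \<and> card e = 2} + card {e \<in> unclaimed n h. \<not> (\<forall>v\<in>e. clean s h v)}"
    by (rule card_Un_le)
  also have "\<dots> \<le> (length h choose 2) + 2 * card (backlog s - dead s) * card (live n s)"
  proof (rule add_mono)
    have "card {e. e \<subseteq> ?T \<and> card e = 2} = card ?T choose 2"
      by (rule n_subsets[OF fin])
    also have "\<dots> \<le> length h choose 2"
      using card_clean_old[OF h] by (intro binomial_right_mono) (simp add: s_def)
    finally show "card {e. e \<subseteq> ?T \<and> card e = 2} \<le> length h choose 2" .
    show "card {e \<in> unclaimed n h. \<not> (\<forall>v\<in>e. clean s h v)} \<le> 2 * card (backlog s - dead s) * card (live n s)"
      using card_unclean_moves[OF h] by (simp only: s_def)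
  qed
  finally show ?thesis .
qed

section \<open>Path minors and paths\<close>

lemma simple_path:
  assumes "(u, v) \<in> {(x, y). x \<in> S \<and> y \<in> S \<and> {x, y} \<in> E}\<^sup>*" "u \<in> S"
  shows "\<exists>vs. vs \<noteq> [] \<and> distinct vs \<and> hd vs = u \<and> last vs = v \<and> set vs \<subseteq> S \<and> successively (\<lambda>x y. {x, y} \<in> E) vs"
  using assms
proof (induction rule: rtrancl_induct)
  case base
  then show ?case by (intro exI[of _ "[u]"]) simp
next
  case (step y z)
  then obtain vs where vs: "vs \<noteq> []" "distinct vs" "hd vs = u" "last vs = y" "set vs \<subseteq> S"
    "successively (\<lambda>x y. {x, y} \<in> E) vs"
    by blast
  show ?case
  proof (cases "z \<in> set vs")
    case True
    then obtain as bs where "vs = as @ z # bs" by (meson split_list)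
    then show ?thesis
      using vs by (intro exI[of _ "as @ [z]"]) (auto simp: successively_append_iff hd_append)
  next
    case False
    then show ?thesis
      using vs step(2) by (intro exI[of _ "vs @ [z]"]) (auto simp: successively_append_iff)
  qed
qed

text \<open>Simple paths through the connected branch sets are concatenated; disjointness keeps the
  list distinct, and every set contributes at least one vertex.\<close>

lemma path_minor_imp_path:
  assumes "is_minor (path_graph k) G" "k > 0"
  obtains p where "inj_on p {..<k}" "\<And>i. Suc i < k \<Longrightarrow> {p i, p (Suc i)} \<in> snd G"
proof -
  obtain S where S: "\<And>i. i < k \<Longrightarrow> induces_connected G (S i)"
    "disjoint_family_on S {..<k}"
    "\<And>i. Suc i < k \<Longrightarrow> \<exists>x\<in>S i. \<exists>y\<in>S (Suc i). {x, y} \<in> snd G"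
  proof -
    obtain S where S: "\<forall>i\<in>{..<k}. induces_connected G (S i)" "disjoint_family_on S {..<k}"
      "\<forall>v w. {v, w} \<in> {{i, Suc i} | i. Suc i < k} \<longrightarrow> (\<exists>x\<in>S v. \<exists>y\<in>S w. {x, y} \<in> snd G)"
      using assms(1) unfolding is_minor_def path_graph_def by auto
    have "\<exists>x\<in>S i. \<exists>y\<in>S (Suc i). {x, y} \<in> snd G" if "Suc i < k" for i
      using that by (intro S(3)[rule_format]) blast
    then show ?thesis using that S(1,2) by auto
  qed
  \<comment> \<open>The claim covers every end \<open>x\<close>, because the edge to the next branch
    set dictates where the path has to stop.\<close>
  have "\<forall>x\<in>S i. \<exists>vs. i < length vs \<and> distinct vs \<and> last vs = x \<and> set vs \<subseteq> (\<Union>j\<le>i. S j)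
    \<and> successively (\<lambda>x y. {x, y} \<in> snd G) vs" if "i < k" for i
    using that
  proof (induction i)
    case 0
    show ?case
    proof
      fix x assume "x \<in> S 0"
      then show "\<exists>vs. 0 < length vs \<and> distinct vs \<and> last vs = x \<and> set vs \<subseteq> (\<Union>j\<le>0. S j)
        \<and> successively (\<lambda>x y. {x, y} \<in> snd G) vs"
        by (intro exI[of _ "[x]"]) simp
    qed
  next
    case (Suc i)
    show ?case
    proof
      fix x assume x: "x \<in> S (Suc i)"
      obtain y z where yz: "y \<in> S i" "z \<in> S (Suc i)" "{y, z} \<in> snd G"
        using S(3)[OF Suc.prems] by blast
      obtain vs where vs: "i < length vs" "distinct vs" "last vs = y" "set vs \<subseteq> (\<Union>j\<le>i. S j)"
        "successively (\<lambda>x y. {x, y} \<in> snd G) vs"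
        using Suc yz(1) by fastforce
      have "(z, x) \<in> {(a, b). a \<in> S (Suc i) \<and> b \<in> S (Suc i) \<and> {a, b} \<in> snd G}\<^sup>*"
        using S(1)[OF Suc.prems] yz(2) x by (auto simp: induces_connected_def)
      from simple_path[OF this yz(2)] obtain ws where ws: "ws \<noteq> []" "distinct ws" "hd ws = z" "last ws = x"
        "set ws \<subseteq> S (Suc i)" "successively (\<lambda>x y. {x, y} \<in> snd G) ws"
        by blast
      have "(\<Union>j\<le>i. S j) \<inter> S (Suc i) = {}"
      proof -
        have "S j \<inter> S (Suc i) = {}" if "j \<le> i" for j
          using disjoint_family_onD[OF S(2), of j "Suc i"] that Suc.prems by simp
        then show ?thesis by blast
      qed
      then have "set vs \<inter> set ws = {}" using vs(4) ws(5) by blast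
      then show "\<exists>vs. Suc i < length vs \<and> distinct vs \<and> last vs = x \<and> set vs \<subseteq> (\<Union>j\<le>Suc i. S j)
        \<and> successively (\<lambda>x y. {x, y} \<in> snd G) vs"
      proof (intro exI[of _ "vs @ ws"] conjI)
        show "Suc i < length (vs @ ws)"
          using vs(1) ws(1) by (cases ws) simp_all
        show "set (vs @ ws) \<subseteq> (\<Union>j\<le>Suc i. S j)"
          using vs(4) ws(5) by (auto simp: atMost_Suc)
        show "successively (\<lambda>x y. {x, y} \<in> snd G) (vs @ ws)"
          using vs(3,5) ws(3,6) yz(3) by (simp add: successively_append_iff)
      qed (use vs ws in simp_all)
    qed
  qed
  note path = this[of "k - 1"]
  obtain x where "x \<in> S (k - 1)"
    using S(1)[of "k - 1"] assms(2) by (auto simp: induces_connected_def)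
  then obtain vs where vs: "k \<le> length vs" "distinct vs" "successively (\<lambda>x y. {x, y} \<in> snd G) vs"
    using path assms(2) by (metis Suc_diff_1 Suc_leI diff_less zero_less_one)
  have "inj_on (\<lambda>i. vs ! i) {..<k}"
    using vs(1,2) by (auto simp: inj_on_def nth_eq_iff_index_eq)
  moreover have "{vs ! i, vs ! Suc i} \<in> snd G" if "Suc i < k" for i
    using vs(1,3) that by (auto simp: successively_conv_nth)
  ultimately show ?thesis using that by blast
qed

section \<open>Plays without long Maker paths\<close>

definition star_round :: "nat \<Rightarrow> history \<Rightarrow> nat \<Rightarrow> bool" where
  "star_round n h i \<longleftrightarrow> star_move (state_of n (take i h)) (take i h) (fst (h ! i))"

text \<open>This is all that excluding long paths requires of a play: no move inside the urgent set
  and at most one hit per urgent period. As \<open>urgent\<close> never shrinks, the end of a period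
  is expressed by all urgent vertices being dead.\<close>

definition contained :: "nat \<Rightarrow> history \<Rightarrow> bool" where
  "contained n h \<longleftrightarrow>
    (\<forall>i<length h. \<not> fst (h ! i) \<subseteq> urgent (state_of n (take i h))) \<and>
    (\<forall>j<length h. \<forall>i<j. fst (h ! i) \<inter> urgent (state_of n (take i h)) \<noteq> {} \<longrightarrow>
      fst (h ! j) \<inter> urgent (state_of n (take j h)) \<noteq> {} \<longrightarrow>
      (\<exists>k\<in>{i..j}. urgent (state_of n (take k h)) \<subseteq> dead (state_of n (take k h))))"

lemma state_of_take_Suc:
  assumes "consistent n b h" "i < length h"
  shows "leaves (state_of n (take (Suc i) h)) = leaves_after (state_of n (take i h)) (take i h) (fst (h ! i))"
    and "urgent (state_of n (take (Suc i) h)) = urgent_after (state_of n (take i h)) (take i h) (fst (h ! i))"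
  using consistent_nth(2)[OF assms] by (simp_all add: state_snoc)

text \<open>The leaf is fresh before its round and condemned, hence not clean, afterwards. So every
  star edge has an end shared with no other star edge, which is what makes them a star
  forest.\<close>

lemma new_leaf_unique:
  assumes h: "consistent n b h" and ij: "i < length h" "j < length h" "i \<noteq> j"
    and star: "star_round n h i" "star_round n h j"
  shows "new_leaf (take i h) (fst (h ! i)) \<notin> fst (h ! j)"
proof
  let ?l = "new_leaf (take i h) (fst (h ! i))"
  assume l: "?l \<in> fst (h ! j)"
  show False
  proof (cases "j < i")
    case True
    then have "fst (h ! j) \<in> maker_edges (take i h)" using ij by (intro maker_edges_nth)
    moreover have "fresh (take i h) ?l" using star(1) by (auto simp: star_round_def intro: new_leaf)
    ultimately show False using l by (auto simp: fresh_def)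
  next
    case False
    have "?l \<in> leaves (state_of n (take (Suc i) h))"
      using star(1) state_of_take_Suc[OF h ij(1)] by (simp add: leaves_after_def star_round_def)
    then have "?l \<in> leaves (state_of n (take j h))"
      using leaves_mono[of "Suc i" j] False ij(3) by auto
    then show False using star(2) l by (auto simp: star_round_def star_move_def clean_def)
  qed
qed

text \<open>A star edge at an urgent vertex must have been played before that vertex became urgent,
  as star moves need clean ends; closure of \<open>urgent\<close> under Maker's edges then carries
  urgency across it.\<close>

lemma dangerous_round_spreads:
  assumes h: "consistent n b h" and i: "i < length h" "\<not> star_round n h i" "z 0 \<in> fst (h ! i)"
    and path: "\<And>l. l < m \<Longrightarrow> \<exists>k<length h. star_round n h k \<and> fst (h ! k) = {z l, z (Suc l)}"
  shows "z m \<in> urgent (state_of n (take (Suc i) h))"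
  using path
proof (induction m)
  case 0
  show ?case
    using i state_of_take_Suc(2)[OF h i(1)] component_refl by (auto simp: urgent_after_def star_round_def)
next
  case (Suc m)
  then have IH: "z m \<in> urgent (state_of n (take (Suc i) h))" by simp
  obtain k where k: "k < length h" "star_round n h k" "fst (h ! k) = {z m, z (Suc m)}"
    using Suc.prems[of m] by auto
  have "k < Suc i"
  proof (rule ccontr)
    assume "\<not> k < Suc i"
    then have "z m \<in> urgent (state_of n (take k h))"
      using IH urgent_mono[of "Suc i" k] by auto
    then show False using k by (auto simp: star_round_def star_move_def clean_def)
  qed
  then have "{z m, z (Suc m)} \<in> maker_edges (take (Suc i) h)"
    using maker_edges_nth[OF k(1)] k(3) by metis
  then show ?case using IH urgent_closed by blast
qed

lemma live_until_played:
  assumes h: "consistent n b h" and "j < length h" "x \<in> fst (h ! j)" "k \<le> j"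
  shows "x \<notin> dead (state_of n (take k h))"
proof -
  have "x \<notin> dead (state_of n (take j h))"
    using dead_isolated consistent_nth(1)[OF h assms(2)] assms(3) by blast
  then show ?thesis using dead_mono[OF assms(4)] by blast
qed

text \<open>The last of three consecutive dangerous edges of a path finds two urgent endpoints if it is the
  middle one, and otherwise is the second hit on vertices that stayed urgent in the meantime.\<close>

lemma three_dangerous_rounds_aux:
  assumes h: "consistent n b h" "contained n h"
    and len: "i1 < length h" "i2 < length h" "i3 < length h"
    and ord: "i1 \<noteq> i2" "i1 < i3" "i2 < i3"
    and e: "x1 \<in> fst (h ! i1)" "x2 \<in> fst (h ! i2)" "x4 \<in> fst (h ! i3)"
    and U1: "x2 \<in> urgent (state_of n (take (Suc i1) h))"
    and U2: "x1 \<in> urgent (state_of n (take (Suc i2) h))" "x4 \<in> urgent (state_of n (take (Suc i2) h))"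
  shows False
proof -
  let ?U = "\<lambda>k. urgent (state_of n (take k h))" and ?D = "\<lambda>k. dead (state_of n (take k h))"
  \<comment> \<open>From round \<open>i2\<close> until its own edge is played, \<open>x4\<close> is
    urgent and live, so no urgent period ends in between.\<close>
  have x4: "x4 \<in> ?U k" "x4 \<notin> ?D k" if "i2 < k" "k \<le> i3" for k
    using U2(2) urgent_mono[of "Suc i2" k n h] live_until_played[OF h(1) len(3) e(3) that(2)] that by auto
  have hit3: "fst (h ! i3) \<inter> ?U i3 \<noteq> {}" using x4[of i3] ord e(3) by auto
  have no: "\<exists>k\<in>{i..i3}. ?U k \<subseteq> ?D k" if "i < i3" "fst (h ! i) \<inter> ?U i \<noteq> {}" for i
    using h(2) that hit3 len(3) unfolding contained_def by blast
  show False
  proof (cases "i1 < i2")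
    case True
    then have x2: "x2 \<in> ?U i2" using U1 urgent_mono[of "Suc i1" i2 n h] by auto
    then obtain k where k: "k \<in> {i2..i3}" "?U k \<subseteq> ?D k" using no[OF ord(3)] e(2) by blast
    moreover have "x2 \<notin> ?D i2" using live_until_played[OF h(1) len(2) e(2)] by simp
    ultimately have "k \<noteq> i2" using x2 by blast
    then show False using x4[of k] k by auto
  next
    case False
    then have "i2 < i1" using ord by simp
    then have "x1 \<in> ?U i1" using U2 urgent_mono[of "Suc i2" i1 n h] by auto
    then obtain k where k: "k \<in> {i1..i3}" "?U k \<subseteq> ?D k" using no[OF ord(2)] e(1) by blast
    then show False using x4[of k] \<open>i2 < i1\<close> by auto
  qed
qed

lemma three_dangerous_rounds:
  assumes h: "consistent n b h" "contained n h"
    and len: "i1 < length h" "i2 < length h" "i3 < length h"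
    and ord: "i1 \<noteq> i2" "i1 \<noteq> i3" "i2 \<noteq> i3"
    and e: "x1 \<in> fst (h ! i1)" "fst (h ! i2) = {x2, x3}" "x4 \<in> fst (h ! i3)"
    and U1: "x2 \<in> urgent (state_of n (take (Suc i1) h))"
    and U2: "x1 \<in> urgent (state_of n (take (Suc i2) h))" "x4 \<in> urgent (state_of n (take (Suc i2) h))"
    and U3: "x3 \<in> urgent (state_of n (take (Suc i3) h))"
  shows False
proof -
  consider "i1 < i3" "i2 < i3" | "i3 < i1" "i2 < i1" | "i1 < i2" "i3 < i2"
    using ord by linarith
  then show False
  proof cases
    case 1
    then show False using three_dangerous_rounds_aux[OF h len ord(1) 1 e(1) _ e(3) U1 U2] e(2) by blast
  next
    case 2
    then show False
      using three_dangerous_rounds_aux[OF h len(3,2,1) _ 2 e(3) _ e(1) U3 U2(2,1)] ord e(2) by blast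
  next
    case 3
    \<comment> \<open>The middle edge comes last; by then both its ends are urgent, which
      \<open>contained\<close> forbids.\<close>
    then have "x2 \<in> urgent (state_of n (take i2 h))" "x3 \<in> urgent (state_of n (take i2 h))"
      using U1 U3 urgent_mono[of "Suc i1" i2 n h] urgent_mono[of "Suc i3" i2 n h] by auto
    then show False using h(2) len(2) e(2) by (auto simp: contained_def)
  qed
qed

lemma next_witness:
  fixes P :: "nat \<Rightarrow> bool"
  assumes "\<exists>i\<in>{j..j + 2}. P i"
  shows "\<exists>i\<ge>j. i \<le> j + 2 \<and> P i \<and> (\<forall>l. j \<le> l \<longrightarrow> l < i \<longrightarrow> \<not> P l)"
proof -
  let ?Q = "\<lambda>i. j \<le> i \<and> P i"
  obtain i where i: "i \<le> j + 2" "?Q i" using assms by auto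
  then have "?Q (LEAST i. ?Q i)" by (intro LeastI[of ?Q])
  moreover have "(LEAST i. ?Q i) \<le> j + 2" using i Least_le[of ?Q i] by linarith
  moreover have "\<not> P l" if "j \<le> l" "l < (LEAST i. ?Q i)" for l
    using not_less_Least[OF that(2)] that(1) by blast
  ultimately show ?thesis by blast
qed

text \<open>Between successive dangerous edges \<open>a\<close>, \<open>b'\<close>, \<open>c\<close>
  of the path there are only star edges, and these transmit urgency in both directions, as
  \<open>three_dangerous_rounds\<close> demands.\<close>

lemma contained_no_path_minor:
  assumes h: "consistent n b h" "contained n h"
  shows "\<not> is_minor (path_graph 11) (maker_graph n h)"
proof
  assume "is_minor (path_graph 11) (maker_graph n h)"
  then obtain p where p: "inj_on p {..<11}" "\<And>i. Suc i < 11 \<Longrightarrow> {p i, p (Suc i)} \<in> maker_edges h"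
    by (rule path_minor_imp_path) (auto simp: maker_graph_def)
  have "\<exists>k<length h. fst (h ! k) = {p i, p (Suc i)}" if "i < 10" for i
    using p(2)[of i] that by (fastforce simp: maker_edges_def in_set_conv_nth image_iff)
  then obtain r where r: "\<And>i. i < 10 \<Longrightarrow> r i < length h" "\<And>i. i < 10 \<Longrightarrow> fst (h ! r i) = {p i, p (Suc i)}"
    by metis
  have peq: "p i = p j \<longleftrightarrow> i = j" if "i < 11" "j < 11" for i j
    using inj_on_eq_iff[OF p(1)] that by simp
  have rneq: "r i \<noteq> r j" if "i < j" "j < 10" for i j
  proof
    assume "r i = r j"
    then have "{p i, p (Suc i)} = {p j, p (Suc j)}" using r(2)[of i] r(2)[of j] that by simp
    then show False using that peq by (auto simp: doubleton_eq_iff)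
  qed
  let ?P = "\<lambda>i. \<not> star_round n h (r i)"
  \<comment> \<open>Both ends of the middle edge lie on its neighbours, so among three star edges
    the leaf of the middle one would be shared.\<close>
  have three: "\<exists>i\<in>{j..j + 2}. ?P i" if "j \<le> 7" for j
  proof (rule ccontr)
    assume "\<not> ?thesis"
    then have star: "star_round n h (r j)" "star_round n h (r (Suc j))" "star_round n h (r (Suc (Suc j)))"
      by auto
    let ?l = "new_leaf (take (r (Suc j)) h) (fst (h ! r (Suc j)))"
    have "?l \<in> fst (h ! r (Suc j))"
      using star(2) by (auto simp: star_round_def intro: new_leaf)
    then have "?l = p (Suc j) \<or> ?l = p (Suc (Suc j))" using r(2)[of "Suc j"] that by auto
    moreover have "?l \<notin> fst (h ! r j)" "?l \<notin> fst (h ! r (Suc (Suc j)))"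
      using new_leaf_unique[OF h(1)] r(1) star rneq[of j "Suc j"] rneq[of "Suc j" "Suc (Suc j)"] that
      by simp_all
    ultimately show False using r(2)[of j] r(2)[of "Suc (Suc j)"] that by auto
  qed
  have "\<exists>i\<in>{0..0 + 2}. ?P i" by (rule three) simp
  then obtain a where "a \<in> {0..0 + 2}" "?P a" by blast
  then have a: "a \<le> 2" "?P a" by simp_all
  have "\<exists>i\<in>{Suc a..Suc a + 2}. ?P i" by (rule three) (use a in simp)
  from next_witness[where P = ?P, OF this]
  obtain b' where b: "Suc a \<le> b'" "b' \<le> Suc a + 2" "?P b'" "\<And>l. Suc a \<le> l \<Longrightarrow> l < b' \<Longrightarrow> \<not> ?P l"
    by (elim exE conjE) (rule that, assumption+, blast)
  have "\<exists>i\<in>{Suc b'..Suc b' + 2}. ?P i" by (rule three) (use a b in simp)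
  from next_witness[where P = ?P, OF this]
  obtain c where c: "Suc b' \<le> c" "c \<le> Suc b' + 2" "?P c" "\<And>l. Suc b' \<le> l \<Longrightarrow> l < c \<Longrightarrow> \<not> ?P l"
    by (elim exE conjE) (rule that, assumption+, blast)
  \<comment> \<open>With at most two star edges in each gap, \<open>a\<close> \<le> 2,
    \<open>b'\<close> \<le> 5 and \<open>c\<close> \<le> 8.\<close>
  have bounds: "a < b'" "b' < c" "c < 10" using a b c by auto
  have forward: "p j \<in> urgent (state_of n (take (Suc (r i)) h))"
    if ij: "i < j" "j < 10" "?P i" and star: "\<And>l. Suc i \<le> l \<Longrightarrow> l < j \<Longrightarrow> \<not> ?P l" for i j
  proof -
    have "p (Suc i + (j - Suc i)) \<in> urgent (state_of n (take (Suc (r i)) h))"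
    proof (rule dangerous_round_spreads[where z = "\<lambda>l. p (Suc i + l)", OF h(1)])
      show "\<exists>k<length h. star_round n h k \<and> fst (h ! k) = {p (Suc i + l), p (Suc i + Suc l)}"
        if "l < j - Suc i" for l
        using that ij(2) r[of "Suc i + l"] star[of "Suc i + l"]
        by (intro exI[of _ "r (Suc i + l)"]) simp
    qed (use ij r[of i] in auto)
    then show ?thesis using ij by simp
  qed
  have backward: "p (Suc i) \<in> urgent (state_of n (take (Suc (r j)) h))"
    if ij: "i < j" "j < 10" "?P j" and star: "\<And>l. Suc i \<le> l \<Longrightarrow> l < j \<Longrightarrow> \<not> ?P l" for i j
  proof -
    have "p (j - (j - Suc i)) \<in> urgent (state_of n (take (Suc (r j)) h))"
    proof (rule dangerous_round_spreads[where z = "\<lambda>l. p (j - l)", OF h(1)])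
      show "\<exists>k<length h. star_round n h k \<and> fst (h ! k) = {p (j - l), p (j - Suc l)}"
        if "l < j - Suc i" for l
        using that ij(2) r[of "j - Suc l"] star[of "j - Suc l"]
        by (intro exI[of _ "r (j - Suc l)"]) (auto simp: Suc_diff_Suc)
    qed (use ij r[of j] in auto)
    then show ?thesis using ij by simp
  qed
  show False
    by (rule three_dangerous_rounds[OF h, of "r a" "r b'" "r c" "p (Suc a)" "p b'" "p (Suc b')" "p c"])
      (use bounds a b c r rneq forward[of a b'] forward[of b' c] backward[of a b'] backward[of b' c] in auto)
qed

section \<open>Exponential moments of random plays\<close>

text \<open>The product is a supermartingale: given the history, Maker's edge is uniform on the
  unclaimed edges, so the next factor has conditional mean at most 1.\<close>

lemma nn_integral_play_product:
  fixes f :: "history \<Rightarrow> nat set \<Rightarrow> real"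
  assumes nonneg: "\<And>g e. 0 \<le> f g e"
    and avg: "\<And>g. consistent n b g \<Longrightarrow> unclaimed n g \<noteq> {} \<Longrightarrow>
      (\<Sum>e\<in>unclaimed n g. f g e) \<le> real (card (unclaimed n g))"
  shows "(\<integral>\<^sup>+h. ennreal (\<Prod>i<length h. f (take i h) (fst (h ! i)))
    \<partial>measure_pmf (play_rounds n (kill_strategy n b) t)) \<le> 1"
proof (induction t)
  case 0
  then show ?case by simp
next
  case (Suc t)
  define F where "F h = (\<Prod>i<length h. f (take i h) (fst (h ! i)))" for h
  have F_nonneg: "0 \<le> F h" for h
    unfolding F_def using nonneg by (intro prod_nonneg) auto
  have F_snoc: "F (g @ [r]) = F g * f g (fst r)" for g r
    by (simp add: F_def lessThan_Suc nth_append mult.commute cong: prod.cong_simp)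
  have step: "(\<integral>\<^sup>+h. ennreal (F h) \<partial>measure_pmf (play_round n (kill_strategy n b) g)) \<le> ennreal (F g)"
    if g: "consistent n b g" for g
  proof (cases "unclaimed n g = {}")
    case True
    then show ?thesis by (simp add: play_round_def)
  next
    case False
    let ?U = "unclaimed n g"
    have card: "card ?U > 0" using False finite_unclaimed by (simp add: card_gt_0_iff)
    have "(\<integral>\<^sup>+h. ennreal (F h) \<partial>measure_pmf (play_round n (kill_strategy n b) g))
        = (\<Sum>e\<in>?U. ennreal (F g * f g e)) / real (card ?U)"
      using False by (simp add: play_round_def nn_integral_pmf_of_set finite_unclaimed F_snoc ennreal_of_nat_eq_real_of_nat)
    also have "\<dots> = ennreal ((\<Sum>e\<in>?U. F g * f g e) / real (card ?U))"
      using card F_nonneg nonneg by (subst sum_ennreal) (auto simp: divide_ennreal sum_nonneg)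
    also have "\<dots> \<le> ennreal (F g)"
    proof (rule ennreal_leI)
      have "(\<Sum>e\<in>?U. F g * f g e) = F g * (\<Sum>e\<in>?U. f g e)" by (simp add: sum_distrib_left)
      also have "\<dots> \<le> F g * real (card ?U)" by (intro mult_left_mono avg g False F_nonneg)
      finally show "(\<Sum>e\<in>?U. F g * f g e) / real (card ?U) \<le> F g" using card by (simp add: field_simps)
    qed
    finally show ?thesis .
  qed
  have "(\<integral>\<^sup>+h. ennreal (F h) \<partial>measure_pmf (play_rounds n (kill_strategy n b) (Suc t)))
    \<le> (\<integral>\<^sup>+g. ennreal (F g) \<partial>measure_pmf (play_rounds n (kill_strategy n b) t))"
    using step consistent_play_rounds by (auto intro!: nn_integral_mono_AE simp: AE_measure_pmf_iff)
  then show ?case using Suc by (simp add: F_def)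
qed

lemma prob_play_product:
  fixes f :: "history \<Rightarrow> nat set \<Rightarrow> real"
  assumes nonneg: "\<And>g e. 0 \<le> f g e"
    and avg: "\<And>g. consistent n b g \<Longrightarrow> unclaimed n g \<noteq> {} \<Longrightarrow>
      (\<Sum>e\<in>unclaimed n g. f g e) \<le> real (card (unclaimed n g))"
    and c: "c > 0"
  shows "measure_pmf.prob (play_rounds n (kill_strategy n b) t)
    {h. c \<le> (\<Prod>i<length h. f (take i h) (fst (h ! i)))} \<le> 1 / c"
proof -
  define F where "F h = (\<Prod>i<length h. f (take i h) (fst (h ! i)))" for h
  let ?p = "play_rounds n (kill_strategy n b) t"
  have F_nonneg: "0 \<le> F h" for h
    unfolding F_def using nonneg by (intro prod_nonneg) auto
  have "emeasure ?p {h. c \<le> F h} = (\<integral>\<^sup>+h. indicator {h. c \<le> F h} h \<partial>?p)"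
    by simp
  also have "\<dots> \<le> (\<integral>\<^sup>+h. ennreal (1 / c) * ennreal (F h) \<partial>?p)"
    using c F_nonneg
    by (intro nn_integral_mono) (auto simp: indicator_def ennreal_mult'[symmetric] divide_simps)
  also have "\<dots> = ennreal (1 / c) * (\<integral>\<^sup>+h. ennreal (F h) \<partial>?p)"
    by (rule nn_integral_cmult) simp
  also have "\<dots> \<le> ennreal (1 / c) * 1"
    using nn_integral_play_product[OF nonneg avg] by (intro mult_left_mono) (auto simp: F_def)
  finally have "ennreal (measure_pmf.prob ?p {h. c \<le> F h}) \<le> ennreal (1 / c)"
    by (simp add: measure_pmf.emeasure_eq_measure)
  then show ?thesis using c by (simp add: F_def ennreal_le_iff)
qed

text \<open>Bernstein's method: for 0 \<le> X \<le> 4 and l \<le> 1/4 one has exp(l X) \<le> 1 + l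
  (1 + 4 l) X, so exp(l (X - (1 + 4 l) m)) has mean at most 1. Rounds outside the window or the
  filter \<open>G\<close>, where no mean bound is available, get the factor 1.\<close>

lemma prob_window_sum:
  fixes X :: "history \<Rightarrow> nat set \<Rightarrow> real"
  assumes X: "\<And>g e. 0 \<le> X g e" "\<And>g e. X g e \<le> 4" and l: "0 < l" "l \<le> 1 / 4"
    and mean: "\<And>g. consistent n b g \<Longrightarrow> unclaimed n g \<noteq> {} \<Longrightarrow> G g \<Longrightarrow>
      (\<Sum>e\<in>unclaimed n g. X g e) \<le> m (length g) * real (card (unclaimed n g))"
  shows "measure_pmf.prob (play_rounds n (kill_strategy n b) T)
    {h. x \<le> (\<Sum>i | i < length h \<and> i \<in> {s..<t} \<and> G (take i h). X (take i h) (fst (h ! i)) - (1 + 4 * l) * m i)}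
    \<le> exp (- l * x)"
proof -
  define f where "f g e = (if length g \<in> {s..<t} \<and> G g
    then exp (l * (X g e - (1 + 4 * l) * m (length g))) else 1)" for g e
  have avg: "(\<Sum>e\<in>unclaimed n g. f g e) \<le> real (card (unclaimed n g))"
    if g: "consistent n b g" "unclaimed n g \<noteq> {}" for g
  proof (cases "length g \<in> {s..<t} \<and> G g")
    case True
    let ?U = "unclaimed n g" and ?m = "m (length g)"
    have "exp (l * X g e) \<le> 1 + l * (1 + 4 * l) * X g e" for e
    proof -
      have "l * X g e \<le> 1 / 4 * 4" using X l by (intro mult_mono) auto
      then have "exp (l * X g e) \<le> 1 + l * X g e + (l * X g e)\<^sup>2"
        using X l by (intro exp_bound) auto
      moreover have "(l * X g e)\<^sup>2 \<le> l * X g e * (l * 4)"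
        unfolding power2_eq_square using X l by (intro mult_left_mono) auto
      ultimately show ?thesis by (simp add: algebra_simps)
    qed
    then have "(\<Sum>e\<in>?U. exp (l * X g e)) \<le> (\<Sum>e\<in>?U. 1 + l * (1 + 4 * l) * X g e)"
      by (intro sum_mono)
    also have "\<dots> = real (card ?U) + l * (1 + 4 * l) * (\<Sum>e\<in>?U. X g e)"
      by (simp add: sum.distrib sum_distrib_left)
    also have "\<dots> \<le> real (card ?U) + l * (1 + 4 * l) * (?m * real (card ?U))"
      using mean[OF g] True l by (intro add_left_mono mult_left_mono) auto
    also have "\<dots> = real (card ?U) * (1 + l * (1 + 4 * l) * ?m)" by (simp add: algebra_simps)
    also have "\<dots> \<le> real (card ?U) * exp (l * (1 + 4 * l) * ?m)"
      by (intro mult_left_mono exp_ge_add_one_self) auto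
    finally have "(\<Sum>e\<in>?U. exp (l * X g e)) * exp (- (l * (1 + 4 * l) * ?m)) \<le>
        real (card ?U) * exp (l * (1 + 4 * l) * ?m) * exp (- (l * (1 + 4 * l) * ?m))"
      by (rule mult_right_mono) simp
    moreover have "(\<Sum>e\<in>?U. f g e) = (\<Sum>e\<in>?U. exp (l * X g e)) * exp (- (l * (1 + 4 * l) * ?m))"
      using True by (auto simp: f_def sum_distrib_right exp_add[symmetric] algebra_simps)
    ultimately show ?thesis by (simp add: mult.assoc exp_add[symmetric])
  next
    case False
    then show ?thesis by (auto simp: f_def)
  qed
  have "(\<Prod>i<length h. f (take i h) (fst (h ! i))) =
    exp (l * (\<Sum>i | i < length h \<and> i \<in> {s..<t} \<and> G (take i h). X (take i h) (fst (h ! i)) - (1 + 4 * l) * m i))"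
    for h
  proof -
    have "(\<Prod>i<length h. f (take i h) (fst (h ! i))) = (\<Prod>i<length h. if i \<in> {s..<t} \<and> G (take i h)
      then exp (l * (X (take i h) (fst (h ! i)) - (1 + 4 * l) * m i)) else 1)"
      by (intro prod.cong) (auto simp: f_def)
    also have "\<dots> = (\<Prod>i | i \<in> {..<length h} \<and> i \<in> {s..<t} \<and> G (take i h).
        exp (l * (X (take i h) (fst (h ! i)) - (1 + 4 * l) * m i)))"
      by (subst prod.inter_filter[symmetric]) auto
    finally show ?thesis by (simp add: exp_sum sum_distrib_left)
  qed
  moreover have "0 \<le> f g e" for g e by (simp add: f_def)
  ultimately have "measure_pmf.prob (play_rounds n (kill_strategy n b) T)
    {h. exp (l * x) \<le> exp (l * (\<Sum>i | i < length h \<and> i \<in> {s..<t} \<and> G (take i h). X (take i h) (fst (h ! i)) - (1 + 4 * l) * m i))}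
    \<le> 1 / exp (l * x)"
    using prob_play_product[of f n b "exp (l * x)" T] avg by simp
  then show ?thesis using l by (simp add: exp_minus field_simps)
qed

text \<open>Each counted round has the factor 1 + a on a hit and 1 otherwise, damped by exp(- a q)
  to mean at most 1. With a = 1 / (q N) the damping costs at most a factor e over the whole window,
  while \<open>k\<close> hits gain at least a^k.\<close>

lemma prob_window_count:
  fixes q :: real
  assumes q: "q > 0" and N: "N > 0" "t - s \<le> N"
    and mean: "\<And>g. consistent n b g \<Longrightarrow> unclaimed n g \<noteq> {} \<Longrightarrow> G g \<Longrightarrow>
      real (card {e \<in> unclaimed n g. H g e}) \<le> q * real (card (unclaimed n g))"
  shows "measure_pmf.prob (play_rounds n (kill_strategy n b) T)
    {h. k \<le> card {i. i < length h \<and> i \<in> {s..<t} \<and> G (take i h) \<and> H (take i h) (fst (h ! i))}}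
    \<le> exp 1 * (q * real N) ^ k"
proof -
  define a where "a = 1 / (q * real N)"
  have a: "a > 0" using q N by (simp add: a_def)
  define f where "f g e = (if length g \<in> {s..<t} \<and> G g
    then (if H g e then 1 + a else 1) * exp (- (a * q)) else 1)" for g e
  have f_nonneg: "0 \<le> f g e" for g e using a by (simp add: f_def)
  have avg: "(\<Sum>e\<in>unclaimed n g. f g e) \<le> real (card (unclaimed n g))"
    if g: "consistent n b g" "unclaimed n g \<noteq> {}" for g
  proof (cases "length g \<in> {s..<t} \<and> G g")
    case True
    let ?U = "unclaimed n g"
    have "(\<Sum>e\<in>?U. if H g e then 1 + a else 1) = (\<Sum>e\<in>?U. 1 + (if H g e then a else 0))"
      by (intro sum.cong) auto
    also have "\<dots> = real (card ?U) + a * real (card {e \<in> ?U. H g e})"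
      using finite_unclaimed by (simp add: sum.distrib sum.inter_filter[symmetric])
    also have "\<dots> \<le> real (card ?U) + a * (q * real (card ?U))"
      using mean[OF g] True a by (intro add_left_mono mult_left_mono) auto
    also have "\<dots> = real (card ?U) * (1 + a * q)" by (simp add: algebra_simps)
    also have "\<dots> \<le> real (card ?U) * exp (a * q)"
      by (intro mult_left_mono exp_ge_add_one_self) auto
    finally have "(\<Sum>e\<in>?U. if H g e then 1 + a else 1) * exp (- (a * q)) \<le>
        real (card ?U) * exp (a * q) * exp (- (a * q))"
      by (rule mult_right_mono) simp
    moreover have "(\<Sum>e\<in>?U. f g e) = (\<Sum>e\<in>?U. if H g e then 1 + a else 1) * exp (- (a * q))"
      using True by (auto simp: f_def sum_distrib_right)
    ultimately show ?thesis by (simp add: mult.assoc exp_add[symmetric])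
  next
    case False
    then show ?thesis by (auto simp: f_def)
  qed
  have "a ^ k * exp (- 1) \<le> (\<Prod>i<length h. f (take i h) (fst (h ! i)))"
    if k: "k \<le> card {i. i < length h \<and> i \<in> {s..<t} \<and> G (take i h) \<and> H (take i h) (fst (h ! i))}" for h
  proof -
    let ?I = "{i \<in> {..<length h}. i \<in> {s..<t} \<and> G (take i h)}"
    have "(\<Prod>i<length h. f (take i h) (fst (h ! i))) = (\<Prod>i<length h. if i \<in> {s..<t} \<and> G (take i h)
      then (if H (take i h) (fst (h ! i)) then 1 + a else 1) * exp (- (a * q)) else 1)"
      by (intro prod.cong) (auto simp: f_def)
    also have "\<dots> = (\<Prod>i\<in>?I. (if H (take i h) (fst (h ! i)) then 1 + a else 1) * exp (- (a * q)))"
      by (subst prod.inter_filter[symmetric]) auto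
    also have "\<dots> = (1 + a) ^ card {i \<in> ?I. H (take i h) (fst (h ! i))} * exp (- (a * q)) ^ card ?I"
      by (simp add: prod.distrib prod.inter_filter[symmetric])
    also have "\<dots> \<ge> a ^ k * exp (- 1)"
    proof (rule mult_mono)
      have "a ^ k \<le> (1 + a) ^ k" using a by (intro power_mono) auto
      also have "\<dots> \<le> (1 + a) ^ card {i \<in> ?I. H (take i h) (fst (h ! i))}"
        using k a by (intro power_increasing) (auto simp: conj_assoc)
      finally show "a ^ k \<le> (1 + a) ^ card {i \<in> ?I. H (take i h) (fst (h ! i))}" .
      have "card ?I \<le> card {s..<t}" by (intro card_mono) auto
      then have "real (card ?I) \<le> real N" using N by simp
      then have "real (card ?I) * (a * q) \<le> real N * (a * q)" using a q by (intro mult_right_mono) auto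
      also have "\<dots> = 1" using q N by (simp add: a_def)
      finally show "exp (- 1) \<le> exp (- (a * q)) ^ card ?I"
        by (simp add: exp_of_nat_mult[symmetric])
    qed (use a in auto)
    finally show ?thesis .
  qed
  then have "measure_pmf.prob (play_rounds n (kill_strategy n b) T)
    {h. k \<le> card {i. i < length h \<and> i \<in> {s..<t} \<and> G (take i h) \<and> H (take i h) (fst (h ! i))}}
    \<le> measure_pmf.prob (play_rounds n (kill_strategy n b) T)
    {h. a ^ k * exp (- 1) \<le> (\<Prod>i<length h. f (take i h) (fst (h ! i)))}"
    by (intro measure_pmf.finite_measure_mono) auto
  also have "\<dots> \<le> 1 / (a ^ k * exp (- 1))"
    using prob_play_product[of f n b "a ^ k * exp (- 1)" T] f_nonneg avg a by simp
  also have "\<dots> = exp 1 * (q * real N) ^ k"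
    by (simp add: a_def exp_minus power_divide power_mult_distrib field_simps)
  finally show ?thesis .
qed

section \<open>Busy periods\<close>

lemma card_insert_le_Suc: "card (insert x A) \<le> Suc (card A)"
  by (cases "finite A") (simp_all add: card_insert_if)

text \<open>While \<open>X\<close> has live vertices, Breaker finishes only vertices of
  \<open>X\<close>, apart from the one current at the start. So deaths are paid for by vertices in
  \<open>X\<close> at the start or added later. Time \<open>s\<close> itself is exempt from
  \<open>busy\<close>: it may be the last idle moment.\<close>

lemma busy_period:
  fixes X :: "state \<Rightarrow> nat set"
  assumes h: "consistent n b h" "n > 0" and st: "s \<le> t" "t \<le> length h"
    and X: "X = urgent \<or> X = (\<lambda>s. backlog s)"
  defines "S \<equiv> \<lambda>i. state_of n (take i h)"
  assumes busy: "\<And>k. s < k \<Longrightarrow> k \<le> t \<Longrightarrow> X (S k) - dead (S k) \<noteq> {}"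
  shows "card (X (S t) - dead (S t)) + card (dead (S t)) \<le>
    card (dead (S s)) + card (X (S s) - dead (S s)) + (\<Sum>i\<in>{s..<t}. card (X (S (Suc i)) - X (S i) - dead (S i))) + 2"
proof -
  have cons: "consistent n b (take i h)" for i using consistent_take[OF h(1)] .
  have sub: "finite A" if "A \<subseteq> {..<n}" for A
    using that by (rule finite_subset) simp
  have "finite (leaves (S i))" "finite (urgent (S i))" and fin_dead: "finite (dead (S i))" for i
    unfolding S_def
    by (intro sub leaves_bound[OF cons h(2)] urgent_bound[OF cons h(2)] dead_bound[OF cons h(2)])+
  then have "finite (X (S i))" for i using X by auto
  note fin = this fin_dead
  have mono: "X (S i) \<subseteq> X (S j)" if "i \<le> j" for i j
    using leaves_mono[OF that, of n h] urgent_mono[OF that, of n h] X by (auto simp: S_def)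
  let ?c = "current (S s)"
  have "(dead (S t) - dead (S s) \<subseteq> insert ?c (X (S t)) \<and> current (S t) \<in> insert ?c (X (S t))) \<and>
    card (X (S t) - dead (S s) - {?c}) \<le>
      card (X (S s) - dead (S s)) + (\<Sum>i\<in>{s..<t}. card (X (S (Suc i)) - X (S i) - dead (S i)))"
    using st busy
  proof (induction t rule: dec_induct)
    case base
    have "card (X (S s) - dead (S s) - {?c}) \<le> card (X (S s) - dead (S s))"
      using fin by (intro card_mono) auto
    then show ?case by simp
  next
    case (step k)
    then have IH: "dead (S k) - dead (S s) \<subseteq> insert ?c (X (S k))" "current (S k) \<in> insert ?c (X (S k))"
      "card (X (S k) - dead (S s) - {?c}) \<le>
        card (X (S s) - dead (S s)) + (\<Sum>i\<in>{s..<k}. card (X (S (Suc i)) - X (S i) - dead (S i)))"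
      by auto
    have k: "k < length h" using step by simp
    note nth = consistent_nth[OF h(1) k]
    have S': "S (Suc k) = state_of n (take k h @ [(fst (h ! k), kill_strategy n b (take k h) (fst (h ! k)))])"
      using nth(2) by (simp add: S_def)
    have Sk: "S k = state_of n (take k h)" by (simp add: S_def)
    have X': "X (S (Suc k)) = urgent (S (Suc k)) \<or> X (S (Suc k)) = backlog (S (Suc k))" using X by auto
    have "X (S (Suc k)) - dead (S (Suc k)) \<noteq> {}" using step by simp
    note bs = busy_step[OF cons h(2) nth(1) X'[unfolded S'] this[unfolded S'], folded S' Sk]
    have m: "X (S k) \<subseteq> X (S (Suc k))" by (intro mono) simp
    \<comment> \<open>A vertex that joins \<open>X\<close> when already dead was dead at time
      \<open>s\<close> or is \<open>?c\<close>, since all other deaths since \<open>s\<close>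
      occurred inside \<open>X\<close>.\<close>
    have "X (S (Suc k)) - dead (S s) - {?c} \<subseteq>
        (X (S k) - dead (S s) - {?c}) \<union> (X (S (Suc k)) - X (S k) - dead (S k))"
      using IH(1) by blast
    then have "card (X (S (Suc k)) - dead (S s) - {?c}) \<le>
        card ((X (S k) - dead (S s) - {?c}) \<union> (X (S (Suc k)) - X (S k) - dead (S k)))"
      using fin by (intro card_mono) auto
    also have "\<dots> \<le> card (X (S k) - dead (S s) - {?c}) + card (X (S (Suc k)) - X (S k) - dead (S k))"
      by (rule card_Un_le)
    finally have "card (X (S (Suc k)) - dead (S s) - {?c}) \<le>
        card (X (S s) - dead (S s)) + (\<Sum>i\<in>{s..<Suc k}. card (X (S (Suc i)) - X (S i) - dead (S i)))"
      using IH(3) step(1) by simp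
    moreover have "dead (S (Suc k)) - dead (S s) \<subseteq> insert ?c (X (S (Suc k)))"
      using IH(1,2) bs(1) m by blast
    moreover have "current (S (Suc k)) \<in> insert ?c (X (S (Suc k)))"
      using IH(2) bs(2) m by (auto simp: subset_iff)
    ultimately show ?case by blast
  qed
  then have D: "dead (S t) - dead (S s) \<subseteq> insert ?c (X (S t))"
    and C: "card (X (S t) - dead (S s) - {?c}) \<le>
      card (X (S s) - dead (S s)) + (\<Sum>i\<in>{s..<t}. card (X (S (Suc i)) - X (S i) - dead (S i)))"
    by auto
  \<comment> \<open>The vertex \<open>?c\<close> may have been left out of the live part and of the
    dead part; one unit for each gives the summand 2.\<close>
  let ?A = "X (S t) - dead (S t) - {?c}" and ?B = "X (S t) \<inter> dead (S t) - dead (S s) - {?c}"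
  have "card (X (S t) - dead (S t)) \<le> card (insert ?c ?A)" using fin by (intro card_mono) auto
  also have "\<dots> \<le> Suc (card ?A)" by (rule card_insert_le_Suc)
  finally have 1: "card (X (S t) - dead (S t)) \<le> Suc (card ?A)" .
  have "card (dead (S t)) \<le> card (dead (S s) \<union> insert ?c ?B)" using D fin by (intro card_mono) auto
  also have "\<dots> \<le> card (dead (S s)) + card (insert ?c ?B)" by (rule card_Un_le)
  also have "\<dots> \<le> card (dead (S s)) + Suc (card ?B)" by (intro add_left_mono card_insert_le_Suc)
  finally have 2: "card (dead (S t)) \<le> card (dead (S s)) + Suc (card ?B)" .
  have "dead (S s) \<subseteq> dead (S t)" using dead_mono[OF st(1), of n h] by (simp add: S_def)
  then have "card ?A + card ?B \<le> card (X (S t) - dead (S s) - {?c})"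
    using fin by (subst card_Un_disjoint[symmetric]) (auto intro!: card_mono)
  then show ?thesis using 1 2 C by linarith
qed

section \<open>The clock\<close>

lemma real_choose_two: "real (m choose 2) = real m * (real m - 1) / 2"
  by (induction m) (simp_all add: numeral_2_eq_2 field_simps)

text \<open>Convexity of the square: it turns quadratic inequalities on an interval into linear ones
  that hold at both ends.\<close>

lemma square_le_chord:
  fixes z :: real
  assumes "a \<le> z" "z \<le> b"
  shows "z\<^sup>2 \<le> (a + b) * z - a * b"
proof -
  have "0 \<le> (z - a) * (b - z)" using assms by simp
  then show ?thesis by (simp add: power2_eq_square algebra_simps)
qed

text \<open>The quadratic changes sign just below 145 / 10000 and stays negative up to 55 / 100,
  which matches the lower limit y = 45 / 100 of \<open>collision_bound\<close>.\<close>

lemma drift_polynomial: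
  fixes z :: real
  shows "145 / 10000 \<le> z \<Longrightarrow> z \<le> 55 / 100 \<Longrightarrow> 141 / 10000 - z + 6 / 5 * z\<^sup>2 \<le> 0"
    and "0 \<le> z \<Longrightarrow> z \<le> 145 / 10000 \<Longrightarrow> 141 / 10000 - z + 6 / 5 * z\<^sup>2 \<le> 141 / 10000"
  using square_le_chord[of "145 / 10000" z "55 / 100"] square_le_chord[of 0 z "145 / 10000"]
  by (simp_all add: power2_eq_square)

text \<open>Here y and \<tau> stand for the clock and the time divided by n, and \<tau>^2 / y^2
  bounds the chance that Maker joins two old vertices. Cancelling (1 - y)^2 leaves (1 + y)^2 \<le>
  6/5 (99/50)^2 y, which is nearly tight at 9 / 20.\<close>

lemma collision_bound:
  fixes y \<tau> :: real
  assumes "9 / 20 \<le> y" "y \<le> 1" "0 \<le> \<tau>" "\<tau> \<le> (1 - y\<^sup>2) / (99 / 50)"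
  shows "\<tau>\<^sup>2 / y\<^sup>2 \<le> 6 / 5 * (1 - y)\<^sup>2 / y"
proof -
  have y: "(1 + y)\<^sup>2 \<le> 6 / 5 * (99 / 50)\<^sup>2 * y"
    using square_le_chord[OF assms(1,2)] assms(1) by (simp add: power2_eq_square algebra_simps)
  have "\<tau>\<^sup>2 \<le> ((1 - y\<^sup>2) / (99 / 50))\<^sup>2" using assms by (intro power_mono) auto
  also have "\<dots> = (1 - y)\<^sup>2 * (1 + y)\<^sup>2 / (99 / 50)\<^sup>2"
    by (simp add: power2_eq_square field_simps)
  also have "\<dots> \<le> (1 - y)\<^sup>2 * (6 / 5 * (99 / 50)\<^sup>2 * y) / (99 / 50)\<^sup>2"
    using y by (intro divide_right_mono mult_left_mono) auto
  also have "\<dots> = 6 / 5 * (1 - y)\<^sup>2 * y" by simp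
  finally have "\<tau>\<^sup>2 / y\<^sup>2 \<le> 6 / 5 * (1 - y)\<^sup>2 * y / y\<^sup>2" by (intro divide_right_mono) auto
  then show ?thesis using assms by (simp add: power2_eq_square)
qed

locale large_board =
  fixes n b :: nat
  assumes n_large: "100000 \<le> n"
    and b_bounds: "99 / 100 * real n < real b + 1" "real b \<le> 99 / 100 * real n"
begin

lemma n_pos: "n > 0" using n_large by simp

text \<open>Approximate number of live vertices after \<open>i\<close> rounds.\<close>

definition clock :: "nat \<Rightarrow> real" where
  "clock i = sqrt ((real n)\<^sup>2 - real n - 2 * (real b + 1) * real i)"

text \<open>Up to this time the clock stays above 0.29 n, as 1 - 1.98 * 0.46 > 0.29^2. It falls
  below 0.315 n, where Breaker can isolate three vertices per round, already at time 0.455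
  n.\<close>

definition in_time :: "nat \<Rightarrow> bool" where
  "in_time i \<longleftrightarrow> real i \<le> 46 / 100 * real n"

lemma in_time_le: "in_time j \<Longrightarrow> i \<le> j \<Longrightarrow> in_time i"
  by (simp add: in_time_def)

lemma clock:
  assumes "in_time i"
  shows clock_square: "(clock i)\<^sup>2 = (real n)\<^sup>2 - real n - 2 * (real b + 1) * real i"
    and clock_ge: "29 / 100 * real n \<le> clock i"
    and clock_le: "clock i \<le> real n"
proof -
  have "2 * (real b + 1) * real i \<le> 2 * (99 / 100 * real n + 1) * (46 / 100 * real n)"
    using assms b_bounds by (intro mult_mono) (auto simp: in_time_def)
  moreover have "100000 * real n \<le> real n * real n" using n_large by (intro mult_right_mono) auto
  ultimately have ge: "(29 / 100 * real n)\<^sup>2 \<le> (real n)\<^sup>2 - real n - 2 * (real b + 1) * real i"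
    by (simp add: power2_eq_square algebra_simps)
  then show "29 / 100 * real n \<le> clock i" unfolding clock_def by (intro real_le_rsqrt) simp
  have "0 \<le> (29 / 100 * real n)\<^sup>2" by simp
  with ge show "(clock i)\<^sup>2 = (real n)\<^sup>2 - real n - 2 * (real b + 1) * real i"
    unfolding clock_def by (intro real_sqrt_pow2) linarith
  have "0 \<le> 2 * (real b + 1) * real i" by simp
  then have "(real n)\<^sup>2 - real n - 2 * (real b + 1) * real i \<le> (real n)\<^sup>2" by linarith
  then show "clock i \<le> real n" unfolding clock_def by (intro real_le_lsqrt) auto
qed

lemma clock_pos: "in_time i \<Longrightarrow> 0 < clock i"
  using clock_ge[of i] n_pos by (meson less_le_trans mult_pos_pos of_nat_0_less_iff divide_pos_pos zero_less_numeral)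

lemma clock_160: "in_time i \<Longrightarrow> 160 \<le> clock i"
  using clock_ge[of i] n_large by linarith

lemma time_bound:
  assumes "in_time i"
  shows "real i / real n \<le> (1 - (clock i / real n)\<^sup>2) / (99 / 50)"
proof -
  have "99 / 50 * real n * real i \<le> 2 * (real b + 1) * real i"
    using b_bounds by (intro mult_right_mono) auto
  also have "\<dots> = (real n)\<^sup>2 - real n - (clock i)\<^sup>2" using clock_square[OF assms] by simp
  finally have "99 / 50 * real n * real i \<le> (real n)\<^sup>2 - (clock i)\<^sup>2" by simp
  then show ?thesis using n_pos by (simp add: field_simps power2_eq_square)
qed

lemma unclaimed_clock:
  assumes "consistent n b g" "in_time (length g)"
  shows "real (card (unclaimed n g)) = (clock (length g))\<^sup>2 / 2"
proof -
  have "0 \<le> (clock (length g))\<^sup>2" by simp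
  then have "2 * (real b + 1) * real (length g) \<le> real n * (real n - 1)"
    unfolding clock_square[OF assms(2)] by (simp add: power2_eq_square right_diff_distrib)
  then have "real ((b + 1) * length g) \<le> real (n choose 2)"
    by (simp add: real_choose_two algebra_simps)
  then have "(b + 1) * length g \<le> n choose 2" by (simp only: of_nat_le_iff)
  from card_unclaimed[OF assms(1) this]
  have "real (card (unclaimed n g)) + real ((b + 1) * length g) = real (n choose 2)"
    by (metis of_nat_add)
  then show ?thesis
    using clock_square[OF assms(2)] by (simp add: real_choose_two power2_eq_square field_simps)
qed

text \<open>With L live vertices, the unclaimed edges number at most L choose 2 and at least (L - 1)
  choose 2 minus the number of rounds. Twice their number is the square of the clock, and as the
  rounds number at most twice the clock, they shift L only by a constant.\<close>

lemma live_clock: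
  assumes "consistent n b g" "in_time (length g)"
  shows "clock (length g) \<le> real (card (live n (state_of n g)))"
    and "real (card (live n (state_of n g))) \<le> clock (length g) + 4"
proof -
  let ?L = "card (live n (state_of n g))" and ?Y = "clock (length g)"
  have Y: "0 < ?Y" using clock_pos assms(2) .
  note U = unclaimed_clock[OF assms]
  have "real (card (unclaimed n g)) \<le> real (?L choose 2)"
    using card_live_lower[of n g] by (simp only: of_nat_le_iff)
  then have "?Y\<^sup>2 \<le> real ?L * (real ?L - 1)" by (simp add: U real_choose_two)
  also have "\<dots> \<le> (real ?L)\<^sup>2" by (simp add: power2_eq_square algebra_simps)
  finally show "?Y \<le> real ?L" by (rule power2_le_imp_le) simp
  have "?L \<ge> 1" using \<open>?Y \<le> real ?L\<close> Y by (cases ?L) auto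
  have "real ((?L - 1) choose 2) \<le> real (card (unclaimed n g) + length g)"
    using card_live_upper[OF assms(1) n_pos] by (simp only: of_nat_le_iff)
  then have 1: "(real ?L - 1) * (real ?L - 2) \<le> ?Y\<^sup>2 + 2 * real (length g)"
    using \<open>?L \<ge> 1\<close> by (simp add: U real_choose_two of_nat_diff algebra_simps)
  have i: "real (length g) \<le> 2 * ?Y" using assms(2) clock_ge[OF assms(2)] by (simp add: in_time_def)
  show "real ?L \<le> ?Y + 4"
  proof (rule ccontr)
    assume "\<not> ?thesis"
    then have "(?Y + 2) * (?Y + 2) < (real ?L - 1) * (real ?L - 2)"
      using Y by (intro mult_strict_mono) auto
    then show False using 1 i by (simp add: power2_eq_square algebra_simps)
  qed
qed

text \<open>Squares of consecutive clock values differ by 2 (b + 1) and the values add up to at most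
  2 \<open>clock i\<close>, so the clock falls by at least (b + 1) / \<open>clock i\<close>,
  essentially the number of vertices isolated in that round.\<close>

lemma clock_sum:
  assumes "s \<le> t" "in_time t"
  shows "(\<Sum>i\<in>{s..<t}. (real b + 1) / clock i) \<le> clock s - clock t"
  using assms
proof (induction t rule: dec_induct)
  case base
  then show ?case by simp
next
  case (step k)
  have T: "in_time k" "in_time (Suc k)" using step.prems in_time_le by auto
  have "(clock k)\<^sup>2 - (clock (Suc k))\<^sup>2 = 2 * (real b + 1)"
    using clock_square[OF T(1)] clock_square[OF T(2)] by (simp add: algebra_simps)
  then have eq: "(clock k - clock (Suc k)) * (clock k + clock (Suc k)) = 2 * (real b + 1)"
    by (simp add: power2_eq_square algebra_simps)
  have pos: "0 < clock k" "0 < clock (Suc k)" using T clock_pos by auto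
  then have "clock (Suc k) \<le> clock k"
    using eq by (metis add_pos_pos diff_ge_0_iff_ge less_eq_real_def mult_neg_pos not_le of_nat_0_le_iff
        add_nonneg_nonneg mult_nonneg_nonneg zero_le_numeral zero_le_one diff_less_0_iff_less)
  then have "(clock k - clock (Suc k)) * (clock k + clock (Suc k)) \<le> (clock k - clock (Suc k)) * (2 * clock k)"
    by (intro mult_left_mono) auto
  then have "(real b + 1) / clock k \<le> clock k - clock (Suc k)"
    using eq pos by (simp add: field_simps)
  then show ?case using step T by simp
qed

text \<open>Bounds the chance of touching an unclean vertex: a backlog of n / 1000 makes at most 2 n
  / 1000 vertices unclean, each in at most 1.025 clock of the clock^2 / 2 unclaimed edges, and 4 *
  1.025 / 1000 = 0.0041.\<close>

definition hit_rate :: "nat \<Rightarrow> real" where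
  "hit_rate i = 41 / 10000 * real n / clock i"

text \<open>The first summand accounts for moves between clean old vertices. The cap 1 is what
  \<open>drift\<close> relies on late in the game, when two vertices can be isolated per
  round.\<close>

definition danger_rate :: "nat \<Rightarrow> real" where
  "danger_rate i = min 1 ((real i)\<^sup>2 / (clock i)\<^sup>2 + hit_rate i)"

lemma danger_rate_bounds: "in_time i \<Longrightarrow> 0 \<le> danger_rate i" "danger_rate i \<le> 1"
  using clock_pos[of i] by (auto simp: danger_rate_def hit_rate_def)

lemma collisions:
  assumes "in_time i" "45 / 100 * real n \<le> clock i"
  shows "(real i)\<^sup>2 / (clock i)\<^sup>2 * (clock i / real n) \<le> 6 / 5 * (1 - clock i / real n)\<^sup>2"
proof -
  let ?y = "clock i / real n"
  have y: "9 / 20 \<le> ?y" "?y \<le> 1" using assms(2) clock_le[OF assms(1)] n_pos by (simp_all add: field_simps)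
  have "(real i / real n)\<^sup>2 / ?y\<^sup>2 \<le> 6 / 5 * (1 - ?y)\<^sup>2 / ?y"
    using time_bound[OF assms(1)] y by (intro collision_bound) auto
  moreover have "(real i / real n)\<^sup>2 / ?y\<^sup>2 = (real i)\<^sup>2 / (clock i)\<^sup>2"
    using n_pos by (simp add: power_divide)
  ultimately have "(real i)\<^sup>2 / (clock i)\<^sup>2 \<le> 6 / 5 * (1 - ?y)\<^sup>2 / ?y" by simp
  moreover have "0 < ?y" using y by linarith
  ultimately show ?thesis by (simp only: pos_le_divide_eq)
qed

lemma drift:
  assumes "in_time i"
  shows "1 + danger_rate i - (real b + 1) / clock i \<le> (if real i < 146 / 10000 * real n then 144 / 10000 else 0)"
    and "455 / 1000 * real n \<le> real i \<Longrightarrow> 2 - (real b + 1) / clock i \<le> - 11 / 10"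
proof -
  let ?y = "clock i / real n" and ?z = "1 - clock i / real n"
  have pos: "0 < clock i" "0 < real n" using clock_pos[OF assms] n_pos by auto
  have y: "0 < ?y" "?y \<le> 1" using pos clock_le[OF assms] by (simp_all add: field_simps)
  have k: "99 / 100 / ?y \<le> (real b + 1) / clock i"
    using b_bounds pos by (simp add: field_simps)
  show "1 + danger_rate i - (real b + 1) / clock i \<le> (if real i < 146 / 10000 * real n then 144 / 10000 else 0)"
  proof (cases "45 / 100 \<le> ?y")
    case False
    \<comment> \<open>Here 0.99 / y even exceeds 2.2, whereas a round condemns at most two
      vertices.\<close>
    then have "2 < 99 / 100 / ?y" by (simp only: pos_less_divide_eq[OF y(1)])
    then have "1 + danger_rate i - (real b + 1) / clock i \<le> 0"
      using k danger_rate_bounds(2)[of i] by linarith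
    then show ?thesis by (rule order_trans) simp
  next
    case True
    then have c: "(real i)\<^sup>2 / (clock i)\<^sup>2 * ?y \<le> 6 / 5 * ?z\<^sup>2"
      using pos by (intro collisions assms) (simp add: field_simps)
    have h: "hit_rate i * ?y = 41 / 10000" using pos by (simp add: hit_rate_def)
    have "danger_rate i * ?y \<le> ((real i)\<^sup>2 / (clock i)\<^sup>2 + hit_rate i) * ?y"
      using y by (intro mult_right_mono) (auto simp: danger_rate_def)
    also have "\<dots> \<le> 6 / 5 * ?z\<^sup>2 + 41 / 10000" unfolding distrib_right using c h by linarith
    finally have d: "danger_rate i * ?y \<le> 6 / 5 * ?z\<^sup>2 + 41 / 10000" .
    have "(1 + danger_rate i - (real b + 1) / clock i) * ?y \<le> (1 + danger_rate i - 99 / 100 / ?y) * ?y"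
      using k y by (intro mult_right_mono) auto
    also have "\<dots> = ?y + danger_rate i * ?y - 99 / 100" using pos by (simp add: field_simps)
    also have "\<dots> \<le> 141 / 10000 - ?z + 6 / 5 * ?z\<^sup>2" using d by simp
    finally have main: "(1 + danger_rate i - (real b + 1) / clock i) * ?y \<le> 141 / 10000 - ?z + 6 / 5 * ?z\<^sup>2" .
    have z: "0 \<le> ?z" "?z \<le> 55 / 100" using y True by auto
    show ?thesis
    proof (cases "145 / 10000 \<le> ?z")
      case True
      have "141 / 10000 - ?z + 6 / 5 * ?z\<^sup>2 \<le> 0"
        using True z(2) by (rule drift_polynomial(1))
      then have "(1 + danger_rate i - (real b + 1) / clock i) * ?y \<le> 0 * ?y" using main by simp
      then have "1 + danger_rate i - (real b + 1) / clock i \<le> 0"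
        using y(1) by (rule mult_right_le_imp_le)
      then show ?thesis by (rule order_trans) simp
    next
      case False
      \<comment> \<open>Only few rounds can have passed: (1 - 0.9855^2) / 1.98 < 0.0146.\<close>
      then have y': "9855 / 10000 < ?y" by simp
      then have "(9855 / 10000)\<^sup>2 < ?y\<^sup>2" by (intro power_strict_mono) auto
      then have "real i / real n < (1 - (9855 / 10000)\<^sup>2) / (99 / 50)"
        using time_bound[OF assms] by simp
      also have "\<dots> < 146 / 10000" by (simp add: power2_eq_square)
      finally have i: "real i < 146 / 10000 * real n" using pos by (simp add: field_simps)
      have "141 / 10000 - ?z + 6 / 5 * ?z\<^sup>2 \<le> 141 / 10000"
        using z(1) False by (intro drift_polynomial(2)) auto
      also have "\<dots> \<le> 144 / 10000 * ?y" using y' by simp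
      finally have "(1 + danger_rate i - (real b + 1) / clock i) * ?y \<le> 144 / 10000 * ?y" using main by simp
      then have "1 + danger_rate i - (real b + 1) / clock i \<le> 144 / 10000"
        using y(1) by (rule mult_right_le_imp_le)
      then show ?thesis using i by simp
    qed
  qed
  \<comment> \<open>Since 1 - 1.98 * 0.455 = 0.0991 < 0.315^2 and 0.99 / 0.315 > 3.1, more than
    three vertices are isolated per round.\<close>
  assume i: "455 / 1000 * real n \<le> real i"
  have "455 / 1000 \<le> real i / real n" using i pos by (simp add: field_simps)
  then have "455 / 1000 \<le> (1 - ?y\<^sup>2) / (99 / 50)" using time_bound[OF assms] by linarith
  moreover have "x \<le> 991 / 10000" if "455 / 1000 \<le> (1 - x) / (99 / 50)" for x :: real
    using that by simp
  ultimately have "?y\<^sup>2 \<le> 991 / 10000" by blast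
  also have "\<dots> \<le> (315 / 1000)\<^sup>2" by (simp add: power2_eq_square)
  finally have "?y\<^sup>2 \<le> (315 / 1000)\<^sup>2" .
  then have "?y \<le> 315 / 1000" by (rule power2_le_imp_le) simp
  then have "31 / 10 \<le> 99 / 100 / ?y" unfolding pos_le_divide_eq[OF y(1)] by linarith
  then show "2 - (real b + 1) / clock i \<le> - 11 / 10" using k by simp
qed

section \<open>Probabilities of dangerous moves\<close>

text \<open>A filter for the exponential moments: the rates of dangerous moves are valid for calm
  histories, and \<open>calm_until\<close> shows that in a typical play the filter removes no round
  in time.\<close>

definition calm :: "history \<Rightarrow> bool" where
  "calm g \<longleftrightarrow> in_time (length g) \<and> real (card (backlog (state_of n g) - dead (state_of n g))) \<le> real n / 1000"

lemma hit_rate_bound: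
  assumes "consistent n b g" "calm g"
  shows "2 * real (card (backlog (state_of n g) - dead (state_of n g))) * real (card (live n (state_of n g)))
    \<le> hit_rate (length g) * real (card (unclaimed n g))"
proof -
  let ?Y = "clock (length g)"
  have T: "in_time (length g)" using assms(2) by (simp add: calm_def)
  have "2 * real (card (backlog (state_of n g) - dead (state_of n g))) * real (card (live n (state_of n g)))
    \<le> 2 * (real n / 1000) * (?Y + 4)"
    using assms(2) live_clock(2)[OF assms(1) T] by (intro mult_mono) (auto simp: calm_def)
  also have "\<dots> \<le> 2 * (real n / 1000) * (41 / 40 * ?Y)"
    using clock_160[OF T] by (intro mult_left_mono) auto
  also have "\<dots> = hit_rate (length g) * (?Y\<^sup>2 / 2)"
    using clock_pos[OF T] by (simp add: hit_rate_def power2_eq_square field_simps)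
  finally show ?thesis by (simp add: unclaimed_clock[OF assms(1) T])
qed

lemma unclean_rate:
  assumes "consistent n b g" "calm g"
  shows "real (card {e \<in> unclaimed n g. \<not> (\<forall>v\<in>e. clean (state_of n g) g v)})
    \<le> hit_rate (length g) * real (card (unclaimed n g))"
proof -
  have "real (card {e \<in> unclaimed n g. \<not> (\<forall>v\<in>e. clean (state_of n g) g v)}) \<le>
    real (2 * card (backlog (state_of n g) - dead (state_of n g)) * card (live n (state_of n g)))"
    using card_unclean_moves[OF assms(1) n_pos] by (simp only: of_nat_le_iff)
  then show ?thesis using hit_rate_bound[OF assms] by simp
qed

lemma dangerous_count:
  assumes "consistent n b g" "calm g"
  shows "real (card {e \<in> unclaimed n g. \<not> star_move (state_of n g) g e})
    \<le> ((real (length g))\<^sup>2 / (clock (length g))\<^sup>2 + hit_rate (length g)) * real (card (unclaimed n g))"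
proof -
  let ?Y = "clock (length g)"
  have T: "in_time (length g)" using assms(2) by (simp add: calm_def)
  have "real (card {e \<in> unclaimed n g. \<not> star_move (state_of n g) g e}) \<le>
    real ((length g choose 2) + 2 * card (backlog (state_of n g) - dead (state_of n g)) * card (live n (state_of n g)))"
    using card_dangerous_moves[OF assms(1) n_pos] by (simp only: of_nat_le_iff)
  also have "\<dots> \<le> (real (length g))\<^sup>2 / 2 + hit_rate (length g) * real (card (unclaimed n g))"
  proof -
    have "real (length g choose 2) \<le> (real (length g))\<^sup>2 / 2"
      by (simp add: real_choose_two power2_eq_square field_simps)
    then show ?thesis using hit_rate_bound[OF assms] by simp
  qed
  also have "(real (length g))\<^sup>2 / 2 = (real (length g))\<^sup>2 / ?Y\<^sup>2 * real (card (unclaimed n g))"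
    using clock_pos[OF T] by (simp add: unclaimed_clock[OF assms(1) T])
  finally show ?thesis by (simp add: distrib_right)
qed

lemma dangerous_rate:
  assumes "consistent n b g" "calm g"
  shows "real (card {e \<in> unclaimed n g. \<not> star_move (state_of n g) g e})
    \<le> danger_rate (length g) * real (card (unclaimed n g))"
proof -
  have "card {e \<in> unclaimed n g. \<not> star_move (state_of n g) g e} \<le> card (unclaimed n g)"
    by (intro card_mono) (auto simp: finite_unclaimed)
  then show ?thesis
    using dangerous_count[OF assms] by (simp add: danger_rate_def min_def)
qed

definition new_urgent :: "history \<Rightarrow> nat set \<Rightarrow> nat" where
  "new_urgent g e = card (urgent_after (state_of n g) g e - urgent (state_of n g) - dead (state_of n g))"

text \<open>For y \<ge> 0.45 the rates give c y \<le> 2 * 0.363 + 4 * 0.0041; later, two vertices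
  per move and two more at unclean ends give 2 * 0.45 + 2 * 0.0041. Both are below 0.91, so urgent
  vertices arrive more slowly than the 0.99 n / clock that Breaker isolates.\<close>

lemma urgent_rate:
  assumes "consistent n b g" "calm g"
  shows "(\<Sum>e\<in>unclaimed n g. min 4 (real (new_urgent g e)))
    \<le> 91 / 100 * real n / clock (length g) * real (card (unclaimed n g))"
proof -
  let ?U = "unclaimed n g" and ?i = "length g" and ?s = "state_of n g"
  let ?y = "clock ?i / real n"
  have T: "in_time ?i" using assms(2) by (simp add: calm_def)
  have pos: "0 < clock ?i" "0 < real n" using clock_pos[OF T] n_pos by auto
  have y: "0 < ?y" "?y \<le> 1" using pos clock_le[OF T] by (simp_all add: field_simps)
  have h: "hit_rate ?i * ?y = 41 / 10000" using pos by (simp add: hit_rate_def)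
  let ?D = "card {e \<in> ?U. \<not> star_move ?s g e}" and ?H = "card {e \<in> ?U. \<not> (\<forall>v\<in>e. clean ?s g v)}"
  have cnt: "(\<Sum>e\<in>?U. of_bool (Q e)) = real (card {e \<in> ?U. Q e})" for Q
    using finite_unclaimed by (simp add: of_bool_def sum.inter_filter[symmetric])
  have "\<exists>c. (\<Sum>e\<in>?U. min 4 (real (new_urgent g e))) \<le> c * real (card ?U) \<and> c * ?y \<le> 91 / 100"
  proof (cases "45 / 100 \<le> ?y")
    case True
    then have c: "(real ?i)\<^sup>2 / (clock ?i)\<^sup>2 * ?y \<le> 6 / 5 * (1 - ?y)\<^sup>2"
      using pos by (intro collisions T) (simp add: field_simps)
    have "(1 - ?y)\<^sup>2 \<le> (55 / 100)\<^sup>2" using True y by (intro power_mono) auto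
    moreover have "(55 / 100 :: real)\<^sup>2 = 3025 / 10000" by (simp add: power2_eq_square)
    ultimately have c': "(real ?i)\<^sup>2 / (clock ?i)\<^sup>2 * ?y \<le> 363 / 1000" using c by linarith
    let ?c = "2 * ((real ?i)\<^sup>2 / (clock ?i)\<^sup>2 + hit_rate ?i) + 2 * hit_rate ?i"
    have "(\<Sum>e\<in>?U. min 4 (real (new_urgent g e)))
        \<le> (\<Sum>e\<in>?U. 2 * of_bool (\<not> star_move ?s g e) + 2 * of_bool (\<not> (\<forall>v\<in>e. clean ?s g v)))"
    proof (rule sum_mono)
      fix e assume "e \<in> ?U"
      from card_new_urgent(1)[OF assms(1) n_pos this]
      have "real (new_urgent g e) \<le> real (2 * of_bool (\<not> star_move ?s g e) + 2 * of_bool (\<not> (\<forall>v\<in>e. clean ?s g v)))"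
        by (simp only: of_nat_le_iff new_urgent_def)
      then show "min 4 (real (new_urgent g e)) \<le> 2 * of_bool (\<not> star_move ?s g e) + 2 * of_bool (\<not> (\<forall>v\<in>e. clean ?s g v))"
        by simp
    qed
    also have "\<dots> = 2 * real ?D + 2 * real ?H"
      by (simp only: sum.distrib sum_distrib_left[symmetric] cnt)
    also have "\<dots> \<le> 2 * (((real ?i)\<^sup>2 / (clock ?i)\<^sup>2 + hit_rate ?i) * real (card ?U))
        + 2 * (hit_rate ?i * real (card ?U))"
      by (intro add_mono mult_left_mono dangerous_count[OF assms] unclean_rate[OF assms]) auto
    also have "\<dots> = ?c * real (card ?U)" by (simp only: distrib_right mult.assoc)
    finally have "(\<Sum>e\<in>?U. min 4 (real (new_urgent g e))) \<le> ?c * real (card ?U)" .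
    moreover have "?c * ?y \<le> 91 / 100"
      unfolding distrib_right distrib_left mult.assoc using c' h by linarith
    ultimately show ?thesis by blast
  next
    case False
    let ?c = "2 + 2 * hit_rate ?i"
    have "(\<Sum>e\<in>?U. min 4 (real (new_urgent g e)))
        \<le> (\<Sum>e\<in>?U. 2 + 2 * of_bool (\<not> (\<forall>v\<in>e. clean ?s g v)))"
    proof (rule sum_mono)
      fix e assume "e \<in> ?U"
      from card_new_urgent(2)[OF assms(1) n_pos this]
      have "real (new_urgent g e) \<le> real (2 + 2 * of_bool (\<not> (\<forall>v\<in>e. clean ?s g v)))"
        by (simp only: of_nat_le_iff new_urgent_def)
      then show "min 4 (real (new_urgent g e)) \<le> 2 + 2 * of_bool (\<not> (\<forall>v\<in>e. clean ?s g v))"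
        by simp
    qed
    also have "\<dots> = 2 * real (card ?U) + 2 * real ?H"
      by (simp only: sum.distrib sum_distrib_left[symmetric] cnt) simp
    also have "\<dots> \<le> ?c * real (card ?U)"
      using unclean_rate[OF assms] by (simp only: distrib_right)
    finally have "(\<Sum>e\<in>?U. min 4 (real (new_urgent g e))) \<le> ?c * real (card ?U)" .
    moreover have "?c * ?y \<le> 91 / 100"
      unfolding distrib_right distrib_left mult.assoc using False h by linarith
    ultimately show ?thesis by blast
  qed
  then obtain c where c: "(\<Sum>e\<in>?U. min 4 (real (new_urgent g e))) \<le> c * real (card ?U)" "c * ?y \<le> 91 / 100"
    by blast
  have "c \<le> 91 / 100 * real n / clock ?i" using c(2) pos by (simp add: field_simps)
  then have "c * real (card ?U) \<le> 91 / 100 * real n / clock ?i * real (card ?U)"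
    by (intro mult_right_mono) auto
  then show ?thesis using c(1) by linarith
qed

text \<open>At most 4 W live urgent vertices, each in at most 1.025 clock unclaimed edges, and at
  most 8 W^2 pairs of them, compared with clock^2 / 2 unclaimed edges; the constants come from clock
  \<ge> 0.29 n.\<close>

lemma urgent_hit_rate:
  assumes "consistent n b g" "in_time (length g)"
    and "card (urgent (state_of n g) - dead (state_of n g)) \<le> 4 * W"
  shows "real (card {e \<in> unclaimed n g. e \<inter> urgent (state_of n g) \<noteq> {}})
      \<le> 31 * real W / real n * real (card (unclaimed n g))"
    and "real (card {e \<in> unclaimed n g. e \<subseteq> urgent (state_of n g)})
      \<le> 191 * (real W)\<^sup>2 / (real n)\<^sup>2 * real (card (unclaimed n g))"
proof -
  let ?s = "state_of n g" and ?Y = "clock (length g)"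
  have Y: "29 / 100 * real n \<le> ?Y" "0 < ?Y" "160 \<le> ?Y" and n: "0 < real n"
    using clock_ge clock_pos clock_160 assms(2) n_pos by auto
  note U = unclaimed_clock[OF assms(1,2)]
  have "real (card {e \<in> unclaimed n g. e \<inter> urgent ?s \<noteq> {}}) \<le> real (card (urgent ?s - dead ?s) * card (live n ?s))"
    using card_edges_touching[OF dead_bound[OF assms(1) n_pos] urgent_bound[OF assms(1) n_pos]]
    by (simp only: of_nat_le_iff)
  also have "\<dots> \<le> real (4 * W) * (?Y + 4)"
    unfolding of_nat_mult using live_clock(2)[OF assms(1,2)] assms(3) Y
    by (intro mult_mono) (auto simp flip: of_nat_mult simp del: of_nat_mult)
  also have "\<dots> \<le> real (4 * W) * (41 / 40 * ?Y)" using Y by (intro mult_left_mono) auto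
  also have "\<dots> = 41 / 10 * real W * ?Y" by simp
  also have "\<dots> \<le> 41 / 10 * real W * (?Y * (100 / 29 * ?Y / real n))"
  proof -
    have "1 \<le> 100 / 29 * ?Y / real n" using Y n by (simp add: field_simps)
    then have "?Y * 1 \<le> ?Y * (100 / 29 * ?Y / real n)" using Y by (intro mult_left_mono) auto
    then show ?thesis by (intro mult_left_mono) auto
  qed
  also have "\<dots> = 820 / 29 * real W / real n * (?Y\<^sup>2 / 2)" by (simp add: power2_eq_square field_simps)
  also have "\<dots> \<le> 31 * real W / real n * (?Y\<^sup>2 / 2)"
    by (intro mult_right_mono divide_right_mono) auto
  finally show "real (card {e \<in> unclaimed n g. e \<inter> urgent ?s \<noteq> {}}) \<le> 31 * real W / real n * real (card (unclaimed n g))"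
    by (simp only: U)
  let ?p = "card (urgent ?s - dead ?s)"
  have "finite (urgent ?s)" using urgent_bound[OF assms(1) n_pos] by (rule finite_subset) simp
  then have "real (card {e \<in> unclaimed n g. e \<subseteq> urgent ?s}) \<le> real (?p choose 2)"
    using card_edges_inside by (simp only: of_nat_le_iff)
  also have "\<dots> \<le> (real ?p)\<^sup>2 / 2" by (simp add: real_choose_two power2_eq_square field_simps)
  also have "\<dots> \<le> (real (4 * W))\<^sup>2 / 2"
  proof -
    have "real ?p \<le> real (4 * W)" using assms(3) by (simp only: of_nat_le_iff)
    then show ?thesis by (intro divide_right_mono power_mono) auto
  qed
  also have "\<dots> = 8 * (real W)\<^sup>2" by (simp add: power2_eq_square)
  also have "\<dots> \<le> 191 * (real W)\<^sup>2 / (real n)\<^sup>2 * ((29 / 100 * real n)\<^sup>2 / 2)"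
    using n by (simp add: power2_eq_square field_simps)
  also have "\<dots> \<le> 191 * (real W)\<^sup>2 / (real n)\<^sup>2 * (?Y\<^sup>2 / 2)"
    using Y n by (intro mult_left_mono divide_right_mono power_mono) auto
  finally show "real (card {e \<in> unclaimed n g. e \<subseteq> urgent ?s}) \<le> 191 * (real W)\<^sup>2 / (real n)\<^sup>2 * real (card (unclaimed n g))"
    by (simp only: U)
qed

end

context large_board
begin

lemma real_n_large: "100000 \<le> real n"
  using n_large by simp

section \<open>Typical plays\<close>

text \<open>The deviation 0.0002 n and the parameter l = 1 / 16000, which inflates the mean by 1 /
  4000, are chosen to fit into the backlog budget n / 1000.\<close>

definition few_dangers :: "nat \<Rightarrow> nat \<Rightarrow> history \<Rightarrow> bool" where
  "few_dangers s t h \<longleftrightarrow> (\<Sum>i | i < length h \<and> i \<in> {s..<t} \<and> calm (take i h).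
     of_bool (\<not> star_move (state_of n (take i h)) (take i h) (fst (h ! i))) - (1 + 4 * (1 / 16000)) * danger_rate i)
     < 2 / 10000 * real n"

text \<open>The inflated rate 1.04 * 0.91 = 0.9464 leaves a gap of 0.0436 to the isolation rate
  0.99, of which the deviation consumes 0.03.\<close>

definition few_urgent :: "nat \<Rightarrow> nat \<Rightarrow> history \<Rightarrow> bool" where
  "few_urgent W s h \<longleftrightarrow> (\<Sum>i | i < length h \<and> i \<in> {s..<s + W} \<and> calm (take i h).
     min 4 (real (new_urgent (take i h) (fst (h ! i)))) - (1 + 4 * (1 / 100)) * (91 / 100 * real n / clock i))
     < 3 / 100 * real W"

text \<open>The bound 4 W is what at most four new live urgent vertices per round accumulate in a
  period of \<open>W\<close> rounds.\<close>

definition quiet :: "nat \<Rightarrow> history \<Rightarrow> bool" where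
  "quiet W g \<longleftrightarrow> in_time (length g) \<and> card (urgent (state_of n g) - dead (state_of n g)) \<le> 4 * W"

definition few_hits :: "nat \<Rightarrow> nat \<Rightarrow> history \<Rightarrow> bool" where
  "few_hits W s h \<longleftrightarrow> card {i. i < length h \<and> i \<in> {s..<s + W} \<and> quiet W (take i h) \<and>
     fst (h ! i) \<inter> urgent (state_of n (take i h)) \<noteq> {}} < 2"

definition no_inner_hit :: "nat \<Rightarrow> history \<Rightarrow> bool" where
  "no_inner_hit W h \<longleftrightarrow> card {i. i < length h \<and> i \<in> {0..<n} \<and> quiet W (take i h) \<and>
     fst (h ! i) \<subseteq> urgent (state_of n (take i h))} < 1"

lemma last_witness:
  fixes t :: nat
  assumes "P s0" "s0 \<le> t"
  obtains s where "s0 \<le> s" "s \<le> t" "P s" "\<And>k. s < k \<Longrightarrow> k \<le> t \<Longrightarrow> \<not> P k"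
proof -
  let ?A = "{s. s \<le> t \<and> P s}"
  have A: "finite ?A" "s0 \<in> ?A" using assms by auto
  then have "Max ?A \<in> ?A" by (intro Max_in) auto
  moreover have "s0 \<le> Max ?A" using A by (intro Max_ge)
  moreover have "\<not> P k" if "Max ?A < k" "k \<le> t" for k
  proof
    assume "P k"
    then have "k \<le> Max ?A" using that(2) A(1) by (intro Max_ge) auto
    then show False using that(1) by simp
  qed
  ultimately show ?thesis using that by blast
qed

end

text \<open>A single finished play outside all exceptional events; everything in this locale is
  deterministic.\<close>

locale typical_play = large_board +
  fixes W :: nat and h :: history
  assumes consistent: "consistent n b h" and finished: "unclaimed n h = {}"
    and W_large: "442 \<le> W"
    and few_dangers: "\<And>s t. s \<le> n \<Longrightarrow> t \<le> n \<Longrightarrow> few_dangers s t h"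
    and few_urgent: "\<And>s. s \<le> n \<Longrightarrow> few_urgent W s h"
    and few_hits: "\<And>s. s \<le> n \<Longrightarrow> few_hits W s h"
    and no_inner_hit: "no_inner_hit W h"
begin

abbreviation S :: "nat \<Rightarrow> state" where
  "S i \<equiv> state_of n (take i h)"

abbreviation played :: "nat \<Rightarrow> nat set" where
  "played i \<equiv> fst (h ! i)"

lemma consistent_prefix: "consistent n b (take i h)"
  by (rule consistent_take[OF consistent])

lemma finite_state:
  "finite (leaves (S i))" "finite (urgent (S i))" "finite (dead (S i))"
  using leaves_bound[OF consistent_prefix n_pos] urgent_bound[OF consistent_prefix n_pos]
    dead_bound[OF consistent_prefix n_pos]
  by (meson finite_lessThan finite_subset)+

lemma in_time_less_length:
  assumes "in_time i"
  shows "i < length h"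
proof (rule ccontr)
  assume "\<not> i < length h"
  then have T: "in_time (length h)" using in_time_le[OF assms] by simp
  show False using unclaimed_clock[OF consistent T] clock_pos[OF T] finished by simp
qed

lemma in_time_less_n: "in_time i \<Longrightarrow> i < n"
  using n_pos by (simp add: in_time_def)

lemma dead_clock:
  assumes "in_time i"
  shows "clock i \<le> real n - real (card (dead (S i)))" "real n - real (card (dead (S i))) \<le> clock i + 4"
proof -
  have "card (live n (S i)) = n - card (dead (S i))"
    using dead_bound[OF consistent_prefix n_pos] by (subst card_Diff_subset) (auto simp: finite_state)
  moreover have "card (dead (S i)) \<le> n"
    using dead_bound[OF consistent_prefix n_pos] card_mono[of "{..<n}"] by fastforce
  ultimately have "real (card (live n (S i))) = real n - real (card (dead (S i)))" by simp
  then show "clock i \<le> real n - real (card (dead (S i)))" "real n - real (card (dead (S i))) \<le> clock i + 4"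
    using live_clock[OF consistent_prefix, of i] assms in_time_less_length[OF assms] by simp_all
qed

text \<open>Deaths are measured by the fall of the clock. Clock and live count differ by at most 4,
  which with the 2 of \<open>busy_period\<close> gives the 6.\<close>

lemma busy_clock:
  assumes st: "s \<le> t" "in_time t"
    and X: "X = urgent \<or> X = (\<lambda>s. backlog s)"
    and busy: "\<And>k. s < k \<Longrightarrow> k \<le> t \<Longrightarrow> X (S k) - dead (S k) \<noteq> {}"
  shows "real (card (X (S t) - dead (S t))) + (\<Sum>i\<in>{s..<t}. (real b + 1) / clock i) \<le>
    real (card (X (S s) - dead (S s))) + (\<Sum>i\<in>{s..<t}. real (card (X (S (Suc i)) - X (S i) - dead (S i)))) + 6"
proof -
  have "t \<le> length h" using in_time_less_length[OF st(2)] by simp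
  from busy_period[OF consistent n_pos st(1) this X busy]
  have "real (card (X (S t) - dead (S t)) + card (dead (S t))) \<le>
    real (card (dead (S s)) + card (X (S s) - dead (S s)) + (\<Sum>i\<in>{s..<t}. card (X (S (Suc i)) - X (S i) - dead (S i))) + 2)"
    by (simp only: of_nat_le_iff)
  moreover have "in_time s" using st in_time_le by blast
  ultimately show ?thesis
    using dead_clock[OF st(2)] dead_clock[OF \<open>in_time s\<close>] clock_sum[OF st] by simp
qed

lemma new_backlog:
  assumes "i < length h"
  shows "card (backlog (S (Suc i)) - backlog (S i) - dead (S i)) \<le> 1 + of_bool (\<not> star_move (S i) (take i h) (played i))"
  using card_new_urgent(3)[OF consistent_prefix n_pos consistent_nth(1)[OF consistent assms]]
  by (simp add: state_of_take_Suc[OF consistent assms])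

lemma new_urgent:
  assumes "i < length h"
  shows "card (urgent (S (Suc i)) - urgent (S i) - dead (S i)) = new_urgent (take i h) (played i)"
    and "new_urgent (take i h) (played i) \<le> 4"
proof -
  show "card (urgent (S (Suc i)) - urgent (S i) - dead (S i)) = new_urgent (take i h) (played i)"
    by (simp add: state_of_take_Suc[OF consistent assms] new_urgent_def)
  have "new_urgent (take i h) (played i) \<le> 2 + 2 * of_bool (\<not> (\<forall>v\<in>played i. clean (S i) (take i h) v))"
    using card_new_urgent(2)[OF consistent_prefix n_pos consistent_nth(1)[OF consistent assms]]
    by (simp only: new_urgent_def)
  also have "\<dots> \<le> 4" by simp
  finally show "new_urgent (take i h) (played i) \<le> 4" .
qed

text \<open>Calmness of all earlier rounds switches off the filter in \<open>few_dangers\<close>, so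
  that event controls the true number of dangerous moves since the last moment \<open>s\<close> with
  empty backlog, and with it the backlog at time \<open>t\<close>.\<close>

lemma calm_until:
  "in_time t \<Longrightarrow> calm (take t h)"
proof (induction t rule: less_induct)
  case (less t)
  let ?B = "\<lambda>i. card (backlog (S i) - dead (S i))"
  have calm: "calm (take i h)" if "i < t" for i
    using less that in_time_le[OF less.prems] by auto
  have T: "in_time i" if "i \<le> t" for i using in_time_le[OF less.prems that] .
  have len: "i < length h" if "i \<le> t" for i using in_time_less_length[OF T[OF that]] .
  obtain s where s: "s \<le> t" "?B s = 0" "\<And>k. s < k \<Longrightarrow> k \<le> t \<Longrightarrow> ?B k \<noteq> 0"
    by (rule last_witness[of "\<lambda>i. ?B i = 0" 0 t]) auto
  let ?J = "\<lambda>i. of_bool (\<not> star_move (S i) (take i h) (played i)) :: real"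
  have "real (?B t) + (\<Sum>i\<in>{s..<t}. (real b + 1) / clock i) \<le>
    real (?B s) + (\<Sum>i\<in>{s..<t}. real (card (backlog (S (Suc i)) - backlog (S i) - dead (S i)))) + 6"
    by (rule busy_clock[OF s(1) less.prems, of "\<lambda>s. backlog s"]) (use s(3) in \<open>force simp: finite_state\<close>)+
  also have "(\<Sum>i\<in>{s..<t}. real (card (backlog (S (Suc i)) - backlog (S i) - dead (S i)))) \<le> (\<Sum>i\<in>{s..<t}. 1 + ?J i)"
  proof (rule sum_mono)
    fix i assume "i \<in> {s..<t}"
    then have "real (card (backlog (S (Suc i)) - backlog (S i) - dead (S i))) \<le>
      real (1 + of_bool (\<not> star_move (S i) (take i h) (played i)))"
      using new_backlog[OF len] by (simp only: of_nat_le_iff) simp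
    then show "real (card (backlog (S (Suc i)) - backlog (S i) - dead (S i))) \<le> 1 + ?J i" by simp
  qed
  finally have "real (?B t) \<le> (\<Sum>i\<in>{s..<t}. 1 + ?J i) - (\<Sum>i\<in>{s..<t}. (real b + 1) / clock i) + 6"
    using s(2) by simp
  also have "(\<Sum>i\<in>{s..<t}. 1 + ?J i) - (\<Sum>i\<in>{s..<t}. (real b + 1) / clock i) =
    (\<Sum>i\<in>{s..<t}. ?J i - (1 + 4 * (1 / 16000)) * danger_rate i)
    + (\<Sum>i\<in>{s..<t}. 1 + danger_rate i - (real b + 1) / clock i) + (\<Sum>i\<in>{s..<t}. danger_rate i / 4000)"
    by (simp add: sum_subtractf[symmetric] sum.distrib[symmetric] algebra_simps)
  finally have main: "real (?B t) \<le> (\<Sum>i\<in>{s..<t}. ?J i - (1 + 4 * (1 / 16000)) * danger_rate i)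
    + (\<Sum>i\<in>{s..<t}. 1 + danger_rate i - (real b + 1) / clock i) + (\<Sum>i\<in>{s..<t}. danger_rate i / 4000) + 6" .
  have "few_dangers s t h"
    using s(1) in_time_less_n[OF less.prems] by (intro few_dangers) auto
  moreover have "{i. i < length h \<and> i \<in> {s..<t} \<and> calm (take i h)} = {s..<t}"
    using len calm by auto
  ultimately have 1: "(\<Sum>i\<in>{s..<t}. ?J i - (1 + 4 * (1 / 16000)) * danger_rate i) < 2 / 10000 * real n"
    by (simp only: few_dangers_def)
  have "(\<Sum>i\<in>{s..<t}. 1 + danger_rate i - (real b + 1) / clock i)
    \<le> (\<Sum>i\<in>{s..<t}. if real i < 146 / 10000 * real n then 144 / 10000 else 0)"
    using T by (intro sum_mono drift(1)) auto
  also have "\<dots> = 144 / 10000 * real (card {i\<in>{s..<t}. real i < 146 / 10000 * real n})"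
    by (simp add: sum.inter_filter[symmetric])
  also have "\<dots> \<le> 144 / 10000 * (146 / 10000 * real n + 1)"
  proof -
    have "card {i\<in>{s..<t}. real i < 146 / 10000 * real n} \<le> card {..<nat \<lceil>146 / 10000 * real n\<rceil>}"
      by (intro card_mono) (auto simp: less_ceiling_iff zless_nat_eq_int_zless)
    then have "real (card {i\<in>{s..<t}. real i < 146 / 10000 * real n}) \<le> real (nat \<lceil>146 / 10000 * real n\<rceil>)"
      by (simp only: card_lessThan of_nat_le_iff)
    also have "\<dots> \<le> 146 / 10000 * real n + 1" by linarith
    finally show ?thesis by (intro mult_left_mono) auto
  qed
  finally have 2: "(\<Sum>i\<in>{s..<t}. 1 + danger_rate i - (real b + 1) / clock i) \<le> 144 / 10000 * (146 / 10000 * real n + 1)" .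
  have "(\<Sum>i\<in>{s..<t}. danger_rate i / 4000) \<le> (\<Sum>i\<in>{s..<t}. 1 / 4000)"
    using danger_rate_bounds T by (intro sum_mono divide_right_mono) auto
  also have "\<dots> \<le> real t / 4000" by simp
  also have "\<dots> \<le> 46 / 100 * real n / 4000" using less.prems by (simp add: in_time_def)
  finally have 3: "(\<Sum>i\<in>{s..<t}. danger_rate i / 4000) \<le> 46 / 100 * real n / 4000" .
  \<comment> \<open>In units of n the budget is 0.0002 for the deviation, 0.00021 for the initial
    positive drift and 0.000115 for the inflated mean; the constants are absorbed as n \<ge>
    100000.\<close>
  have "real (?B t) \<le> real n / 1000"
    using main 1 2 3 real_n_large by argo
  then show ?case
    using less.prems len[of t] by (simp add: calm_def)
qed

text \<open>From time 0.455 n to 0.46 n a busy Breaker gains at least 1.1 vertices per round on the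
  backlog, hence about 0.0055 n in total, more than the n / 1000 present at the start.\<close>

lemma backlog_empties:
  "\<exists>t. in_time t \<and> 455 / 1000 * real n \<le> real t \<and> backlog (S t) \<subseteq> dead (S t)"
proof (rule ccontr)
  assume "\<not> ?thesis"
  then have no: "\<not> backlog (S t) \<subseteq> dead (S t)" if "in_time t" "455 / 1000 * real n \<le> real t" for t
    using that by blast
  define s where "s = nat \<lceil>455 / 1000 * real n\<rceil>"
  define t where "t = nat \<lfloor>46 / 100 * real n\<rfloor>"
  have s: "455 / 1000 * real n \<le> real s" "real s \<le> 455 / 1000 * real n + 1"
    unfolding s_def by linarith+
  have t: "real t \<le> 46 / 100 * real n" "46 / 100 * real n - 1 \<le> real t"
    unfolding t_def by linarith+
  have T: "in_time t" using t by (simp add: in_time_def)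
  have "real s \<le> real t" using s t real_n_large by linarith
  then have st: "s \<le> t" by simp
  have Ti: "in_time i" if "i \<le> t" for i using in_time_le[OF T that] .
  have "real (card (backlog (S t) - dead (S t))) + (\<Sum>i\<in>{s..<t}. (real b + 1) / clock i) \<le>
    real (card (backlog (S s) - dead (S s))) + (\<Sum>i\<in>{s..<t}. real (card (backlog (S (Suc i)) - backlog (S i) - dead (S i)))) + 6"
  proof (rule busy_clock[OF st T, of "\<lambda>s. backlog s"])
    fix k assume k: "s < k" "k \<le> t"
    then have "real s \<le> real k" by simp
    then have "\<not> backlog (S k) \<subseteq> dead (S k)" using s k Ti by (intro no) auto
    then show "backlog (S k) - dead (S k) \<noteq> {}" by blast
  qed simp
  moreover have "(\<Sum>i\<in>{s..<t}. real (card (backlog (S (Suc i)) - backlog (S i) - dead (S i)))) \<le> (\<Sum>i\<in>{s..<t}. 2)"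
  proof (rule sum_mono)
    fix i assume i: "i \<in> {s..<t}"
    have "card (backlog (S (Suc i)) - backlog (S i) - dead (S i)) \<le> 1 + of_bool (\<not> star_move (S i) (take i h) (played i))"
      using i in_time_less_length[OF Ti[of i]] by (intro new_backlog) auto
    also have "\<dots> \<le> 2" by simp
    finally show "real (card (backlog (S (Suc i)) - backlog (S i) - dead (S i))) \<le> 2" by simp
  qed
  moreover have "(\<Sum>i\<in>{s..<t}. 2 - (real b + 1) / clock i) \<le> (\<Sum>i\<in>{s..<t}. - 11 / 10)"
  proof (rule sum_mono)
    fix i assume "i \<in> {s..<t}"
    then have "in_time i" "real s \<le> real i" using Ti by auto
    then show "2 - (real b + 1) / clock i \<le> - 11 / 10" using s by (intro drift(2)) auto
  qed
  moreover have "(\<Sum>i\<in>{s..<t}. - 11 / 10 :: real) = - 11 / 10 * (real t - real s)"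
    using st by (simp add: of_nat_diff)
  moreover have "calm (take s h)" using Ti[OF st] by (rule calm_until)
  then have "real (card (backlog (S s) - dead (S s))) \<le> real n / 1000" by (simp add: calm_def)
  moreover have "0 \<le> real (card (backlog (S t) - dead (S t)))" by simp
  ultimately have "11 / 10 * (real t - real s) \<le> real n / 1000 + 6"
    unfolding sum_subtractf by linarith
  then show False using s t real_n_large by argo
qed

text \<open>At time \<open>t\<close> three times the number of live vertices is at most
  \<open>b\<close>, and that number only falls; so the argument continues beyond the range of the
  clock until the end of the game.\<close>

lemma backlog_empty_after:
  assumes "in_time t" "455 / 1000 * real n \<le> real t" "backlog (S t) \<subseteq> dead (S t)"
    and "t \<le> k" "k \<le> length h"
  shows "backlog (S k) \<subseteq> dead (S k)"
  using assms(4,5)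
proof (induction k rule: dec_induct)
  case base
  show ?case by (rule assms(3))
next
  case (step k)
  have k: "k < length h" using step by simp
  have "31 / 10 \<le> (real b + 1) / clock t" using drift(2)[OF assms(1,2)] by linarith
  then have "31 / 10 * clock t \<le> real b + 1" using clock_pos[OF assms(1)] by (simp add: pos_le_divide_eq)
  moreover have "real (card (live n (S t))) \<le> clock t + 4"
    using live_clock(2)[OF consistent_prefix, of t] assms(1) in_time_less_length[OF assms(1)] by simp
  moreover have "card (live n (S k)) \<le> card (live n (S t))"
    using dead_mono[OF step(1), of n h] by (intro card_mono) auto
  ultimately have "real (3 * card (live n (S k))) \<le> real b"
    using b_bounds real_n_large by simp
  then have small: "3 * card (live n (S k)) \<le> b" by (simp only: of_nat_le_iff)
  have "backlog (S k) \<subseteq> dead (S k)" using step k by simp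
  from backlog_stays_empty[OF consistent_prefix n_pos consistent_nth(1)[OF consistent k] this small]
  show ?case using consistent_nth(2)[OF consistent k] by simp
qed

text \<open>Over \<open>W\<close> busy rounds Breaker isolates 0.99 n / clock per round, while fewer
  than 0.9464 n / clock + 0.03 on average arrive. As clock \<le> n, the surplus is at least 0.0136
  per round, and 442 is the least integer \<open>W\<close> for which this exceeds the 6 of
  \<open>busy_clock\<close>.\<close>

lemma urgent_period_short:
  assumes j: "in_time j" and s: "s \<le> j" "urgent (S s) \<subseteq> dead (S s)"
    and busy: "\<And>k. s < k \<Longrightarrow> k \<le> j \<Longrightarrow> \<not> urgent (S k) \<subseteq> dead (S k)"
  shows "j < s + W"
proof (rule ccontr)
  assume "\<not> j < s + W"
  then have le: "s + W \<le> j" by simp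
  have T: "in_time i" if "i \<le> s + W" for i using in_time_le[OF j] le that by simp
  let ?I = "{s..<s + W}" and ?w = "\<lambda>i. real (new_urgent (take i h) (played i))"
  have len: "i < length h" if "i \<in> ?I" for i using in_time_less_length[OF T] that by simp
  have "real (card (urgent (S (s + W)) - dead (S (s + W)))) + (\<Sum>i\<in>?I. (real b + 1) / clock i) \<le>
    real (card (urgent (S s) - dead (S s))) + (\<Sum>i\<in>?I. real (card (urgent (S (Suc i)) - urgent (S i) - dead (S i)))) + 6"
    by (rule busy_clock) (use T busy le in auto)
  moreover have "urgent (S s) - dead (S s) = {}" using s(2) by blast
  moreover have "(\<Sum>i\<in>?I. real (card (urgent (S (Suc i)) - urgent (S i) - dead (S i)))) = (\<Sum>i\<in>?I. ?w i)"
    using len new_urgent(1) by (intro sum.cong) auto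
  ultimately have main: "(\<Sum>i\<in>?I. (real b + 1) / clock i) \<le> (\<Sum>i\<in>?I. ?w i) + 6" by simp
  have "few_urgent W s h" using s(1) in_time_less_n[OF j] by (intro few_urgent) simp
  moreover have "{i. i < length h \<and> i \<in> ?I \<and> calm (take i h)} = ?I"
    using len calm_until T by auto
  ultimately have "(\<Sum>i\<in>?I. min 4 (?w i) - (1 + 4 * (1 / 100)) * (91 / 100 * real n / clock i)) < 3 / 100 * real W"
    by (simp only: few_urgent_def)
  moreover have "(\<Sum>i\<in>?I. min 4 (?w i) - (1 + 4 * (1 / 100)) * (91 / 100 * real n / clock i)) =
    (\<Sum>i\<in>?I. ?w i - 9464 / 10000 * (real n / clock i))"
    using len new_urgent(2) by (intro sum.cong) auto
  ultimately have few: "(\<Sum>i\<in>?I. ?w i) - (\<Sum>i\<in>?I. 9464 / 10000 * (real n / clock i)) < 3 / 100 * real W"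
    by (simp add: sum_subtractf)
  have "(\<Sum>i\<in>?I. 9464 / 10000 * (real n / clock i) + 436 / 10000) \<le> (\<Sum>i\<in>?I. (real b + 1) / clock i)"
  proof (rule sum_mono)
    fix i assume "i \<in> ?I"
    then have i: "0 < clock i" "clock i \<le> real n" using T clock_pos clock_le by auto
    have "1 \<le> real n / clock i" using i by simp
    moreover have "99 / 100 * (real n / clock i) \<le> (real b + 1) / clock i"
      using i b_bounds by (simp add: divide_simps)
    ultimately show "9464 / 10000 * (real n / clock i) + 436 / 10000 \<le> (real b + 1) / clock i" by linarith
  qed
  moreover have "(\<Sum>i\<in>?I. 9464 / 10000 * (real n / clock i) + 436 / 10000) =
    (\<Sum>i\<in>?I. 9464 / 10000 * (real n / clock i)) + 436 / 10000 * real W"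
    by (simp add: sum.distrib)
  ultimately have "436 / 10000 * real W < 3 / 100 * real W + 6" using main few by linarith
  then show False using W_large by linarith
qed

lemma card_urgent_growth:
  assumes "s \<le> k" "k \<le> length h" "urgent (S s) \<subseteq> dead (S s)"
  shows "card (urgent (S k) - dead (S k)) \<le> 4 * (k - s)"
  using assms(1,2)
proof (induction k rule: dec_induct)
  case base
  have "urgent (S s) - dead (S s) = {}" using assms(3) by blast
  then show ?case by (simp only: card.empty)
next
  case (step k)
  have k: "k < length h" using step by simp
  have "dead (S k) \<subseteq> dead (S (Suc k))" by (rule dead_mono) simp
  then have "urgent (S (Suc k)) - dead (S (Suc k)) \<subseteq>
      (urgent (S k) - dead (S k)) \<union> (urgent (S (Suc k)) - urgent (S k) - dead (S k))"
    by blast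
  then have "card (urgent (S (Suc k)) - dead (S (Suc k))) \<le>
      card ((urgent (S k) - dead (S k)) \<union> (urgent (S (Suc k)) - urgent (S k) - dead (S k)))"
    by (intro card_mono) (auto simp: finite_state)
  also have "\<dots> \<le> card (urgent (S k) - dead (S k)) + card (urgent (S (Suc k)) - urgent (S k) - dead (S k))"
    by (rule card_Un_le)
  also have "\<dots> \<le> 4 * (k - s) + 4"
    using step k new_urgent[OF k] by (intro add_mono) auto
  finally show ?case using step(1) by (simp add: Suc_diff_le)
qed

text \<open>All hits occur before \<open>t\<close>, as later every urgent vertex is dead. A hit
  before \<open>t\<close> lies in an urgent period; traced back to its start \<open>s\<close>, the
  period is shorter than \<open>W\<close> and quiet throughout, so \<open>few_hits\<close> and
  \<open>no_inner_hit\<close> count its hits.\<close>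

lemma contained: "contained n h"
proof -
  obtain t where t: "in_time t" "455 / 1000 * real n \<le> real t" "backlog (S t) \<subseteq> dead (S t)"
    using backlog_empties by blast
  have late: "urgent (S k) \<subseteq> dead (S k)" if "t \<le> k" "k \<le> length h" for k
    using backlog_empty_after[OF t that] by blast
  have live: "x \<notin> dead (S i)" if "i < length h" "x \<in> played i" for i x
    using live_until_played[OF consistent that] by simp
  have start: "urgent (S 0) \<subseteq> dead (S 0)" by simp
  have period: "\<exists>s\<le>i. j < s + W \<and> urgent (S s) \<subseteq> dead (S s) \<and>
      (\<forall>k\<in>{s..j}. quiet W (take k h))"
    if ij: "i \<le> j" "j < t" and busy: "\<And>k. i \<le> k \<Longrightarrow> k \<le> j \<Longrightarrow> \<not> urgent (S k) \<subseteq> dead (S k)" for i j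
  proof -
    obtain s where s: "s \<le> i" "urgent (S s) \<subseteq> dead (S s)"
        "\<And>k. s < k \<Longrightarrow> k \<le> i \<Longrightarrow> \<not> urgent (S k) \<subseteq> dead (S k)"
      by (rule last_witness[of "\<lambda>s. urgent (S s) \<subseteq> dead (S s)" 0 i]) (use start in auto)
    have T: "in_time k" if "k \<le> j" for k using in_time_le[OF t(1)] ij that by simp
    have busy': "\<not> urgent (S k) \<subseteq> dead (S k)" if "s < k" "k \<le> j" for k
      using s(3)[of k] busy[of k] that by (cases "k \<le> i") auto
    have "j < s + W"
      using ij s busy' T by (intro urgent_period_short) auto
    moreover have "quiet W (take k h)" if "k \<in> {s..j}" for k
    proof -
      have k: "k < length h" using in_time_less_length T that by simp
      have "card (urgent (S k) - dead (S k)) \<le> 4 * (k - s)"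
        using that k s(2) by (intro card_urgent_growth) auto
      also have "\<dots> \<le> 4 * W" using that \<open>j < s + W\<close> by auto
      finally show ?thesis using T[of k] that k by (simp add: quiet_def)
    qed
    ultimately show ?thesis using s by blast
  qed
  have "\<not> played i \<subseteq> urgent (S i)" if i: "i < length h" for i
  proof
    assume sub: "played i \<subseteq> urgent (S i)"
    obtain u where u: "u \<in> played i"
      using unclaimed_edge[OF consistent_nth(1)[OF consistent i]] by (metis insertI1)
    then have nd: "\<not> urgent (S i) \<subseteq> dead (S i)" using sub live[OF i] by blast
    then have it: "i < t" using late[of i] i by (meson le_less_linear less_imp_le)
    then obtain s where "s \<le> i" "\<forall>k\<in>{s..i}. quiet W (take k h)"
      using period[of i i] nd by auto
    then have "quiet W (take i h)" by simp
    have "i < n" using it in_time_less_n[OF t(1)] by simp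
    let ?I = "{i. i < length h \<and> i \<in> {0..<n} \<and> quiet W (take i h) \<and> played i \<subseteq> urgent (S i)}"
    have "i \<in> ?I" using i sub \<open>quiet W (take i h)\<close> \<open>i < n\<close> by simp
    moreover have "finite ?I" by simp
    ultimately have "0 < card ?I" unfolding card_gt_0_iff by blast
    then show False using no_inner_hit unfolding no_inner_hit_def by linarith
  qed
  moreover have "\<exists>k\<in>{i..j}. urgent (S k) \<subseteq> dead (S k)"
    if ij: "i < j" "j < length h" and hit: "played i \<inter> urgent (S i) \<noteq> {}" "played j \<inter> urgent (S j) \<noteq> {}" for i j
  proof (rule ccontr)
    assume "\<not> ?thesis"
    then have busy: "\<not> urgent (S k) \<subseteq> dead (S k)" if "i \<le> k" "k \<le> j" for k using that by auto
    then have jt: "j < t" using late[of j] ij by (meson le_less_linear less_imp_le order_refl)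
    obtain s where s: "s \<le> i" "j < s + W" "\<forall>k\<in>{s..j}. quiet W (take k h)"
      using period[of i j] ij jt busy by auto
    let ?H = "{i. i < length h \<and> i \<in> {s..<s + W} \<and> quiet W (take i h) \<and> played i \<inter> urgent (S i) \<noteq> {}}"
    have "{i, j} \<subseteq> ?H" using s ij hit by auto
    moreover have "finite ?H" by simp
    ultimately have "card {i, j} \<le> card ?H" by (intro card_mono)
    then have "2 \<le> card ?H" using ij by simp
    moreover have "few_hits W s h"
      using s(1) ij jt in_time_less_n[OF t(1)] by (intro few_hits) simp
    ultimately show False by (simp add: few_hits_def)
  qed
  ultimately show ?thesis unfolding contained_def by blast
qed

end

section \<open>Union bound over the exceptional events\<close>

context large_board
begin

abbreviation play :: "history pmf" where
  "play \<equiv> random_play n (kill_strategy n b)"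

lemma prob_many_dangers: "measure_pmf.prob play {h. \<not> few_dangers s t h} \<le> exp (- (1 / 16000) * (2 / 10000 * real n))"
proof -
  have "(\<Sum>e\<in>unclaimed n g. of_bool (\<not> star_move (state_of n g) g e)) \<le> danger_rate (length g) * real (card (unclaimed n g))"
    if "consistent n b g" "calm g" for g
    using dangerous_rate[OF that] finite_unclaimed by (simp add: of_bool_def sum.inter_filter[symmetric])
  then show ?thesis
    unfolding few_dangers_def random_play_def not_less
    by (intro prob_window_sum[where X = "\<lambda>g e. of_bool (\<not> star_move (state_of n g) g e)" and G = calm]) auto
qed

lemma prob_many_urgent: "measure_pmf.prob play {h. \<not> few_urgent W s h} \<le> exp (- (1 / 100) * (3 / 100 * real W))"
  unfolding few_urgent_def random_play_def not_less
  using urgent_rate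
  by (intro prob_window_sum[where X = "\<lambda>g e. min 4 (real (new_urgent g e))" and G = calm
        and m = "\<lambda>i. 91 / 100 * real n / clock i"]) auto

lemma prob_many_hits:
  assumes "W > 0"
  shows "measure_pmf.prob play {h. \<not> few_hits W s h} \<le> exp 1 * (31 * real W / real n * real W)\<^sup>2"
  unfolding few_hits_def random_play_def not_less
  using assms n_pos urgent_hit_rate(1)
  by (intro prob_window_count[where H = "\<lambda>g e. e \<inter> urgent (state_of n g) \<noteq> {}" and G = "quiet W"])
    (auto simp: quiet_def)

lemma prob_inner_hit:
  assumes "W > 0"
  shows "measure_pmf.prob play {h. \<not> no_inner_hit W h} \<le> exp 1 * (191 * (real W)\<^sup>2 / (real n)\<^sup>2 * real n)"
proof -
  have "measure_pmf.prob play {h. \<not> no_inner_hit W h} \<le> exp 1 * (191 * (real W)\<^sup>2 / (real n)\<^sup>2 * real n) ^ 1"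
    unfolding no_inner_hit_def random_play_def not_less
    using assms n_pos urgent_hit_rate(2)
    by (intro prob_window_count[where H = "\<lambda>g e. e \<subseteq> urgent (state_of n g)" and G = "quiet W"])
      (auto simp: quiet_def)
  then show ?thesis by simp
qed

lemma breaker_win_prob_bound:
  assumes W: "442 \<le> W"
  shows "1 - ((real n + 1)\<^sup>2 * exp (- (1 / 16000) * (2 / 10000 * real n)) +
      (real n + 1) * exp (- (1 / 100) * (3 / 100 * real W)) +
      (real n + 1) * (exp 1 * (31 * real W / real n * real W)\<^sup>2) +
      exp 1 * (191 * (real W)\<^sup>2 / (real n)\<^sup>2 * real n))
    \<le> breaker_win_prob (path_graph 11) n (kill_strategy n b)"
proof -
  define A where "A = (\<Union>x\<in>{..n} \<times> {..n}. {h. \<not> few_dangers (fst x) (snd x) h})"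
  define B where "B = (\<Union>s\<in>{..n}. {h. \<not> few_urgent W s h})"
  define C where "C = (\<Union>s\<in>{..n}. {h. \<not> few_hits W s h})"
  define D where "D = {h. \<not> no_inner_hit W h}"
  let ?M = "{h. is_minor (path_graph 11) (maker_graph n h)}"
  have UN: "measure_pmf.prob play (\<Union>x\<in>I. F x) \<le> real (card I) * c"
    if "finite I" "\<And>x. x \<in> I \<Longrightarrow> measure_pmf.prob play (F x) \<le> c" for I :: "'i set" and F c
  proof -
    have "measure_pmf.prob play (\<Union>x\<in>I. F x) \<le> (\<Sum>x\<in>I. measure_pmf.prob play (F x))"
      using that(1) by (intro measure_pmf.finite_measure_subadditive_finite) auto
    also have "\<dots> \<le> (\<Sum>x\<in>I. c)" using that(2) by (rule sum_mono)
    finally show ?thesis by simp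
  qed
  have cards: "real (card ({..n} \<times> {..n})) = (real n + 1)\<^sup>2" "real (card {..n}) = real n + 1"
    by (simp_all add: card_cartesian_product power2_eq_square algebra_simps)
  \<comment> \<open>Restricting to the support makes the history consistent and finished, as
    \<open>typical_play\<close> requires.\<close>
  have "?M \<inter> set_pmf play \<subseteq> A \<union> B \<union> C \<union> D"
  proof
    fix h assume h: "h \<in> ?M \<inter> set_pmf play"
    show "h \<in> A \<union> B \<union> C \<union> D"
    proof (rule ccontr)
      assume no: "h \<notin> A \<union> B \<union> C \<union> D"
      have "consistent n b h" using h by (auto simp: random_play_def intro: consistent_play_rounds)
      moreover have "unclaimed n h = {}" using h unclaimed_random_play by blast
      ultimately interpret typical_play n b W h
        using no W by unfold_locales (auto simp: A_def B_def C_def D_def)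
      show False using contained_no_path_minor[OF consistent contained] h by simp
    qed
  qed
  then have "measure_pmf.prob play ?M \<le> measure_pmf.prob play (A \<union> B \<union> C \<union> D)"
    by (subst measure_Int_set_pmf[symmetric]) (intro measure_pmf.finite_measure_mono, auto)
  also have "\<dots> \<le> measure_pmf.prob play A + measure_pmf.prob play B + measure_pmf.prob play C + measure_pmf.prob play D"
    by (intro order_trans[OF measure_Un_le] add_mono order_refl) auto
  also have "\<dots> \<le> real (card ({..n} \<times> {..n})) * exp (- (1 / 16000) * (2 / 10000 * real n)) +
      real (card {..n}) * exp (- (1 / 100) * (3 / 100 * real W)) +
      real (card {..n}) * (exp 1 * (31 * real W / real n * real W)\<^sup>2) +
      exp 1 * (191 * (real W)\<^sup>2 / (real n)\<^sup>2 * real n)"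
    unfolding A_def B_def C_def D_def using W
    by (intro add_mono UN prob_many_dangers prob_many_urgent prob_many_hits prob_inner_hit) auto
  finally have "measure_pmf.prob play ?M \<le> (real n + 1)\<^sup>2 * exp (- (1 / 16000) * (2 / 10000 * real n)) +
      (real n + 1) * exp (- (1 / 100) * (3 / 100 * real W)) +
      (real n + 1) * (exp 1 * (31 * real W / real n * real W)\<^sup>2) +
      exp 1 * (191 * (real W)\<^sup>2 / (real n)\<^sup>2 * real n)"
    by (simp only: cards)
  moreover have "breaker_win_prob (path_graph 11) n (kill_strategy n b) = 1 - measure_pmf.prob play ?M"
  proof -
    have "{h. \<not> is_minor (path_graph 11) (maker_graph n h)} = space (measure_pmf play) - ?M" by auto
    then show ?thesis
      using measure_pmf.prob_compl[of ?M play] by (simp add: breaker_win_prob_def)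
  qed
  ultimately show ?thesis by linarith
qed

end

theorem theorem2:
  "\<exists>\<sigma> :: nat \<Rightarrow> strategy.
     (\<forall>n. breaker_strategy n (nat \<lfloor>0.99 * real n\<rfloor>) (\<sigma> n)) \<and>
     (\<lambda>n. breaker_win_prob (path_graph 11) n (\<sigma> n)) \<longlonglongrightarrow> 1"
proof (intro exI conjI allI)
  let ?\<sigma> = "\<lambda>n. kill_strategy n (nat \<lfloor>0.99 * real n\<rfloor>)"
  show "breaker_strategy n (nat \<lfloor>0.99 * real n\<rfloor>) (?\<sigma> n)" for n
    by (rule breaker_strategy_kill_strategy)
  \<comment> \<open>The integer \<open>W\<close> is replaced by n powr (1/5), or by n powr (1/5) - 1
    where the bound decreases in \<open>W\<close>. The dominant term, of order n powr (-1/5), comes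
    from two hits in one window.\<close>
  define err :: "nat \<Rightarrow> real" where "err n =
    (real n + 1)\<^sup>2 * exp (- (1 / 16000) * (2 / 10000 * real n)) +
    (real n + 1) * exp (- (1 / 100) * (3 / 100 * (real n powr (1 / 5) - 1))) +
    (real n + 1) * (exp 1 * (31 * real n powr (1 / 5) / real n * real n powr (1 / 5))\<^sup>2) +
    exp 1 * (191 * (real n powr (1 / 5))\<^sup>2 / (real n)\<^sup>2 * real n)" for n
  have "err \<longlonglongrightarrow> 0" unfolding err_def by real_asymp
  then have lim: "(\<lambda>n. 1 - err n) \<longlonglongrightarrow> 1" using tendsto_diff[of "\<lambda>_. 1" 1 _ err 0] by simp
  \<comment> \<open>Rounding down costs less than 1, hence 443 in place of 442.\<close>
  have lower: "1 - err n \<le> breaker_win_prob (path_graph 11) n (?\<sigma> n)"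
    if n: "100000 \<le> n" "443 \<le> real n powr (1 / 5)" for n
  proof -
    interpret large_board n "nat \<lfloor>0.99 * real n\<rfloor>"
    proof
      show "100000 \<le> n" by (rule n(1))
      have eq: "(0.99 :: real) = 99 / 100" by simp
      show "99 / 100 * real n < real (nat \<lfloor>0.99 * real n\<rfloor>) + 1" unfolding eq by linarith
      show "real (nat \<lfloor>0.99 * real n\<rfloor>) \<le> 99 / 100 * real n" unfolding eq by (rule of_nat_floor) simp
    qed
    define W where "W = nat \<lfloor>real n powr (1 / 5)\<rfloor>"
    have W: "real n powr (1 / 5) - 1 \<le> real W" "real W \<le> real n powr (1 / 5)"
      unfolding W_def by (linarith, intro of_nat_floor, simp)
    then have "442 \<le> W" using n(2) by linarith
    moreover have "31 * real W / real n * real W \<le> 31 * real n powr (1 / 5) / real n * real n powr (1 / 5)"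
      using W(2) by (intro mult_mono divide_right_mono) auto
    then have "(real n + 1) * (exp 1 * (31 * real W / real n * real W)\<^sup>2) \<le>
        (real n + 1) * (exp 1 * (31 * real n powr (1 / 5) / real n * real n powr (1 / 5))\<^sup>2)"
      by (intro mult_left_mono power_mono) auto
    moreover have "exp 1 * (191 * (real W)\<^sup>2 / (real n)\<^sup>2 * real n) \<le>
        exp 1 * (191 * (real n powr (1 / 5))\<^sup>2 / (real n)\<^sup>2 * real n)"
      using W(2) by (intro mult_left_mono mult_right_mono divide_right_mono power_mono) auto
    moreover have "(real n + 1) * exp (- (1 / 100) * (3 / 100 * real W)) \<le>
        (real n + 1) * exp (- (1 / 100) * (3 / 100 * (real n powr (1 / 5) - 1)))"
      using W(1) by (intro mult_left_mono) auto
    ultimately show ?thesis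
      using breaker_win_prob_bound[of W] unfolding err_def by linarith
  qed
  have "\<forall>\<^sub>F n in sequentially. 443 \<le> real n powr (1 / 5)" by real_asymp
  then have "\<forall>\<^sub>F n in sequentially. 1 - err n \<le> breaker_win_prob (path_graph 11) n (?\<sigma> n)"
    using eventually_ge_at_top[of 100000] by eventually_elim (rule lower)
  moreover have "\<forall>\<^sub>F n in sequentially. breaker_win_prob (path_graph 11) n (?\<sigma> n) \<le> 1"
    by (simp add: breaker_win_prob_def)
  ultimately show "(\<lambda>n. breaker_win_prob (path_graph 11) n (?\<sigma> n)) \<longlonglongrightarrow> 1"
    by (rule tendsto_sandwich[OF _ _ lim tendsto_const])
qed

end
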